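(* Let $s$ be an integer, let $x_1,x_2,x_3\in\mathbb{C}$ satisfy $x_1+x_2+x_3=s$, and let $\lambda\in\mathbb{C}$ satisfy $\operatorname{Re}(\lambda+1-s)>0$. Assume that $x_1,x_2,x_3$ and $\lambda$ are not non-positive integers and that all terms below are well defined. Then $$\frac{\Gamma(x_1)\Gamma(x_2)\Gamma(x_3)}{\Gamma(1-x_1)\Gamma(1-x_2)\Gamma(1-x_3)}=\sum_{k=0}^\infty\frac{(-1)^{s+1}\left((\xi_k)_{k+s-1}\right)^2}{(k!)^2}\left(\frac{1}{x_1+k}+\frac{1}{x_2+k}+\frac{1}{x_3+k}-\frac{1}{\lambda+k}\right),$$ where $$\xi_k=\frac{2-s-k}{2}+\sqrt{\left(\frac{s+k-2\lambda}{2}\right)^2+\frac{(x_1-\lambda)(x_2-\lambda)(x_3-\lambda)}{\lambda+k}}.$$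
   Context: For an integer $k$, $(a)_k=\Gamma(a+k)/\Gamma(a)$, that is, $(a)_k=a(a+1)\cdots(a+k-1)$ for $k\ge 0$ and $(a)_k=\left[(a-1)(a-2)\cdots(a+k)\right]^{-1}$ for $k<0$. The reciprocal gamma function $1/\Gamma$ is understood as an entire function. The square root in $\xi_k$ may be taken with either sign; the squared quantity $\left((\xi_k)_{k+s-1}\right)^2$ does not depend on this choice. "Well defined" means that no factor occurring in a denominator vanishes (including those in $(\xi_k)_{k+s-1}$ when $k+s-1<0$). *)

theory Defs
  imports "HOL-Analysis.Analysis"
begin

definition int_pochhammer :: "complex \<Rightarrow> int \<Rightarrow> complex" where
  "int_pochhammer a m =
     (if m \<ge> 0 then pochhammer a (nat m)
      else inverse (\<Prod>j = 1..nat (- m). a - of_nat j))"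

text \<open>No denominator factor of \<open>int_pochhammer a m\<close> vanishes; this is a restriction only for
  \<open>m < 0\<close>.\<close>

definition int_pochhammer_well_defined :: "complex \<Rightarrow> int \<Rightarrow> bool" where
  "int_pochhammer_well_defined a m \<longleftrightarrow>
     (m < 0 \<longrightarrow> (\<forall>j\<in>{1..nat (- m)}. a - of_nat j \<noteq> 0))"

text \<open>The expression under the square root in \<open>\<xi>\<^sub>k\<close>.\<close>

definition xi_radicand ::
  "int \<Rightarrow> complex \<Rightarrow> complex \<Rightarrow> complex \<Rightarrow> complex \<Rightarrow> nat \<Rightarrow> complex" where
  "xi_radicand s x1 x2 x3 l k =
     ((of_int s + of_nat k - 2 * l) / 2)\<^sup>2
     + (x1 - l) * (x2 - l) * (x3 - l) / (l + of_nat k)"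

text \<open>\<open>\<xi>\<^sub>k\<close>, with \<open>r\<close> a chosen square root of the radicand.\<close>

definition xi :: "int \<Rightarrow> nat \<Rightarrow> complex \<Rightarrow> complex" where
  "xi s k r = (2 - of_int s - of_nat k) / 2 + r"

end

theory Submission
  imports Defs
begin

text \<open>
  Write \<open>P(t) = (t - x1) (t - x2) (t - x3)\<close> and move the three points inside the pencil
  \<open>P(t) + (t - l) y\<close>, whose members all have the same root sum \<open>s\<close> and the same value at \<open>t = l\<close>.
  Therefore \<open>(x1 - l) (x2 - l) (x3 - l)\<close>, and with it every \<open>xi\<close>, is constant along the pencil. The
  left-hand side, as a function of \<open>y\<close>, has poles only where some \<open>- k\<close> is a root, that is at
  \<open>y\<^sub>k = P(-k) / (l + k)\<close>, because \<open>P(-k) - (l + k) y\<close> is linear in \<open>y\<close>. The theorem is the partial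
  fraction expansion in \<open>y\<close>, evaluated at \<open>y = 0\<close>; the sum of reciprocals minus \<open>1 / (l + k)\<close> is the
  factor by which the residue at a simple pole enters (\<open>pole_quadratic_at_pole\<close>).

  The expansion is obtained as a limit of finite ones instead of from a contour integral. The Gamma quotient is the limit of \<open>N\<close> to the power \<open>2 s - 3\<close> times
  the product of \<open>- P(j+1) / P(-j)\<close> over \<open>j < N\<close>, since the root sum is \<open>s\<close>
  (\<open>Gamma_product_LIMSEQ\<close>). Along the pencil this product is a rational function of \<open>y\<close> with an
  elementary expansion into \<open>N\<close> fractions and a constant, its value at infinity.
  At \<open>y = y\<^sub>k\<close> the member of the pencil is \<open>t + k\<close> times a quadratic \<open>q\<^sub>k\<close>, symmetric about
  \<open>(s + k) / 2\<close> (\<open>cubic_pencil_factor\<close>). Thus \<open>q\<^sub>k(-j) = q\<^sub>k(s + k + j)\<close>, the products of the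
  values of \<open>q\<^sub>k\<close> in numerator and denominator of the residue nearly cancel, and with
  \<open>m = k + s - 1\<close> there remains the product of \<open>q\<^sub>k(i)\<close> for \<open>0 < i \<le> m\<close>
  (extended to negative \<open>m\<close> by \<open>shift_prod\<close>), which is \<open>(-1)\<^sup>m\<close> times the
  squared Pochhammer symbol, divided by the same product for \<open>N < i \<le> N + m\<close>
  (\<open>truncated_expansion\<close>, \<open>shift_prod_eq_int_pochhammer_square\<close>).

  The limit of large \<open>N\<close> is taken termwise by Tannery's theorem, and the hypothesis
  \<open>Re (l + 1 - s) > 0\<close> is what makes all of this work. It sends the value at infinity to \<open>0\<close>
  (\<open>value_at_infinity_LIMSEQ\<close>). One root of \<open>q\<^sub>k\<close> tends to \<open>l\<close>, so with \<open>\<tau> = root + 1 - s\<close> the real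
  part of \<open>\<tau>\<close> is eventually bounded below by a positive constant; then the \<open>k\<close>-th term is
  of order at most \<open>k\<close> to the power \<open>- 1 - Re (l + 1 - s)\<close> (\<open>prod_shifted_upper_bound\<close>), and the factor
  by which truncation changes it is bounded uniformly in \<open>k < N\<close> (\<open>prod_shifted_lower_bound\<close>).
\<close>

section \<open>Partial fractions and the cubic pencil\<close>

text \<open>Adding the factor with index \<open>n\<close> splits every fraction with pole \<open>u k\<close> into one with pole \<open>u k\<close> and
  one with pole \<open>u n\<close>; the latter add up to the residue at \<open>u n\<close> by the induction hypothesis
  at \<open>y = u n\<close>.\<close>

lemma partial_fractions_product:
  fixes \<alpha> \<beta> u :: "nat \<Rightarrow> 'a::field"
  assumes "inj_on u {..<n}" and "\<And>j. j < n \<Longrightarrow> y \<noteq> u j"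
  shows "(\<Prod>j<n. (\<alpha> j + \<beta> j * y) / (y - u j)) =
           (\<Prod>j<n. \<beta> j) +
           (\<Sum>k<n. (\<Prod>j<n. \<alpha> j + \<beta> j * u k) / (\<Prod>j\<in>{..<n}-{k}. u k - u j) / (y - u k))"
  using assms
proof (induction n arbitrary: y)
  case 0
  then show ?case by simp
next
  case (Suc n)
  define f where "f = (\<lambda>y. (\<Prod>j<n. (\<alpha> j + \<beta> j * y) / (y - u j)))"
  define \<rho> where "\<rho> = (\<lambda>k. (\<Prod>j<n. \<alpha> j + \<beta> j * u k) / (\<Prod>j\<in>{..<n}-{k}. u k - u j))"
  define c where "c = (\<Prod>j<n. \<beta> j)"
  have inj: "inj_on u {..<n}" using Suc.prems(1) by (auto simp: inj_on_def)
  have IH: "f z = c + (\<Sum>k<n. \<rho> k / (z - u k))" if "\<And>j. j < n \<Longrightarrow> z \<noteq> u j" for z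
    using Suc.IH[OF inj that] unfolding f_def \<rho>_def c_def by blast
  have un: "u n \<noteq> u j" if "j < n" for j
    using inj_onD[OF Suc.prems(1), of n j] that by auto
  have yn: "y \<noteq> u n" and yk: "\<And>j. j < n \<Longrightarrow> y \<noteq> u j" using Suc.prems(2) by auto
  define \<rho>' where "\<rho>' = (\<lambda>k. (\<Prod>j<Suc n. \<alpha> j + \<beta> j * u k) / (\<Prod>j\<in>{..<Suc n}-{k}. u k - u j))"
  have \<rho>'k: "\<rho>' k = \<rho> k * (\<alpha> n + \<beta> n * u k) / (u k - u n)" if "k < n" for k
  proof -
    have "{..<Suc n}-{k} = insert n ({..<n}-{k})" using that by auto
    then show ?thesis unfolding \<rho>'_def \<rho>_def by (simp add: field_simps)
  qed
  have \<rho>'n: "\<rho>' n = (\<alpha> n + \<beta> n * u n) * f (u n)"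
  proof -
    have "{..<Suc n}-{n} = {..<n}" by auto
    then show ?thesis unfolding \<rho>'_def f_def by (simp add: prod_dividef)
  qed
  have split: "\<rho> k / (y - u k) * ((\<alpha> n + \<beta> n * y) / (y - u n)) =
      \<rho>' k / (y - u k) + (\<alpha> n + \<beta> n * u n) / (y - u n) * (\<rho> k / (u n - u k))" if "k < n" for k
  proof -
    have nz: "y - u k \<noteq> 0" "y - u n \<noteq> 0" "u n - u k \<noteq> 0" "u k - u n \<noteq> 0"
      using yk[OF that] yn un[OF that] by auto
    have "(\<alpha> n + \<beta> n * y) / ((y - u k) * (y - u n)) =
        (\<alpha> n + \<beta> n * u k) / ((u k - u n) * (y - u k)) +
        (\<alpha> n + \<beta> n * u n) / ((y - u n) * (u n - u k))"
      using nz by (simp add: divide_simps) (simp add: algebra_simps)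
    then have "\<rho> k * ((\<alpha> n + \<beta> n * y) / ((y - u k) * (y - u n))) =
       \<rho> k * ((\<alpha> n + \<beta> n * u k) / ((u k - u n) * (y - u k))) +
       \<rho> k * ((\<alpha> n + \<beta> n * u n) / ((y - u n) * (u n - u k)))"
      by (simp only: distrib_left)
    then show ?thesis unfolding \<rho>'k[OF that] by (simp add: mult_ac)
  qed
  have split0: "c * ((\<alpha> n + \<beta> n * y) / (y - u n)) = c * \<beta> n + (\<alpha> n + \<beta> n * u n) / (y - u n) * c"
  proof -
    have "y - u n \<noteq> 0" using yn by auto
    then show ?thesis by (simp add: divide_simps) (simp add: algebra_simps)
  qed
  have "(\<Prod>j<Suc n. (\<alpha> j + \<beta> j * y) / (y - u j)) = f y * ((\<alpha> n + \<beta> n * y) / (y - u n))"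
    by (simp add: f_def)
  also have "\<dots> = c * ((\<alpha> n + \<beta> n * y) / (y - u n)) +
      (\<Sum>k<n. \<rho> k / (y - u k) * ((\<alpha> n + \<beta> n * y) / (y - u n)))"
    using IH[OF yk] by (simp only: distrib_right sum_distrib_right)
  also have "\<dots> = c * \<beta> n + (\<alpha> n + \<beta> n * u n) / (y - u n) * c +
      (\<Sum>k<n. \<rho>' k / (y - u k) + (\<alpha> n + \<beta> n * u n) / (y - u n) * (\<rho> k / (u n - u k)))"
    using split split0 by simp
  also have "\<dots> = c * \<beta> n + (\<Sum>k<n. \<rho>' k / (y - u k)) +
      (\<alpha> n + \<beta> n * u n) / (y - u n) * (c + (\<Sum>k<n. \<rho> k / (u n - u k)))"
    by (simp add: sum.distrib sum_distrib_left distrib_left)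
  also have "(c + (\<Sum>k<n. \<rho> k / (u n - u k))) = f (u n)"
    using IH[of "u n"] un by simp
  also have "c * \<beta> n + (\<Sum>k<n. \<rho>' k / (y - u k)) + (\<alpha> n + \<beta> n * u n) / (y - u n) * f (u n) =
      (\<Prod>j<Suc n. \<beta> j) + (\<Sum>k<Suc n. \<rho>' k / (y - u k))"
    by (simp add: c_def \<rho>'n)
  finally show ?case unfolding \<rho>'_def .
qed

text \<open>The cofactor of \<open>t + k\<close> in the member of the pencil that has the root \<open>- k\<close>; its roots are
  \<open>1 - xi\<close> for the two choices of the square root. It is defined from the radicand
  rather than by division, so that it makes sense, and is continuous in \<open>l\<close>, also when \<open>t = - k\<close>.\<close>

definition pole_quadratic ::
  "int \<Rightarrow> complex \<Rightarrow> complex \<Rightarrow> complex \<Rightarrow> complex \<Rightarrow> nat \<Rightarrow> complex \<Rightarrow> complex" where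
  "pole_quadratic s x1 x2 x3 l k t =
     (t - (of_int s + of_nat k) / 2)\<^sup>2 - xi_radicand s x1 x2 x3 l k"

definition cubic :: "complex \<Rightarrow> complex \<Rightarrow> complex \<Rightarrow> complex \<Rightarrow> complex" where
  "cubic x1 x2 x3 t = (t - x1) * (t - x2) * (t - x3)"

text \<open>Both sides are monic cubics in \<open>t\<close> which vanish at \<open>- k\<close>, have root sum \<open>s\<close> and agree at \<open>t = l\<close>; the
  shape of the radicand expresses exactly the last condition.\<close>

lemma cubic_pencil_factor:
  assumes "x1 + x2 + x3 = of_int s" and "l + of_nat k \<noteq> 0"
  shows "cubic x1 x2 x3 t + (t - l) * (cubic x1 x2 x3 (- of_nat k) / (l + of_nat k)) =
           (t + of_nat k) * pole_quadratic s x1 x2 x3 l k t"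
proof -
  define K where "K = (of_nat k :: complex)"
  define d where "d = l + K"
  have d: "d \<noteq> 0" "K = d - l" using assms(2) by (auto simp: d_def K_def)
  have q: "pole_quadratic s x1 x2 x3 l k t =
      (t - l) * (t + l - (x1 + x2 + x3) - K) - (x1 - l) * (x2 - l) * (x3 - l) / d"
    unfolding pole_quadratic_def xi_radicand_def assms(1)[symmetric] K_def[symmetric] d_def
    by (simp add: power2_eq_square field_simps)
  show ?thesis
    unfolding q unfolding cubic_def K_def[symmetric] d_def[symmetric]
    using d(1) unfolding d(2) by (simp add: divide_simps) algebra
qed

lemma pole_quadratic_reflect:
  "pole_quadratic s x1 x2 x3 l k (of_int s + of_nat k - t) = pole_quadratic s x1 x2 x3 l k t"
  unfolding pole_quadratic_def by (simp add: power2_eq_square field_simps)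

definition reciprocal_term :: "complex \<Rightarrow> complex \<Rightarrow> complex \<Rightarrow> complex \<Rightarrow> nat \<Rightarrow> complex" where
  "reciprocal_term x1 x2 x3 l k =
     1 / (x1 + of_nat k) + 1 / (x2 + of_nat k) + 1 / (x3 + of_nat k) - 1 / (l + of_nat k)"

text \<open>The value of the cofactor at \<open>- k\<close> is the derivative of the member of the pencil there, namely
  \<open>P'(-k) + P(-k) / (l + k)\<close>, and the reciprocals of \<open>x + k\<close> add up to
  minus the logarithmic derivative of \<open>P\<close> at \<open>- k\<close>.\<close>

lemma pole_quadratic_at_pole:
  assumes "x1 + x2 + x3 = of_int s" and "l + of_nat k \<noteq> 0"
    and "x1 + of_nat k \<noteq> 0" "x2 + of_nat k \<noteq> 0" "x3 + of_nat k \<noteq> 0"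
  shows "pole_quadratic s x1 x2 x3 l k (- of_nat k) =
           - cubic x1 x2 x3 (- of_nat k) * reciprocal_term x1 x2 x3 l k"
proof -
  define K where "K = (of_nat k :: complex)"
  define a b c d where "a = x1 + K" and "b = x2 + K" and "c = x3 + K" and "d = l + K"
  have x: "x1 = a - K" "x2 = b - K" "x3 = c - K" "l = d - K"
    unfolding a_def b_def c_def d_def by auto
  have nz: "a \<noteq> 0" "b \<noteq> 0" "c \<noteq> 0" "d \<noteq> 0"
    using assms(2-) unfolding a_def b_def c_def d_def K_def by auto
  have s: "of_int s = a + b + c - 3 * K" using assms(1)[symmetric] unfolding x by (simp add: algebra_simps)
  show ?thesis
    unfolding pole_quadratic_def cubic_def xi_radicand_def reciprocal_term_def s K_def[symmetric] x
    using nz by (simp add: field_simps power2_eq_square)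
qed

section \<open>The expansion of the truncated product\<close>

text \<open>The partial fraction expansion at \<open>y = 0\<close>, under the assumption that the poles \<open>u k\<close> are distinct and
  that \<open>- k\<close> is a simple root of the member of the pencil at \<open>u k\<close>. Up to sign, \<open>(l + j) (u k - u j)\<close>
  is the value of that member at \<open>- j\<close>, so the denominators of the residues are products of values of
  the quadratic as well.\<close>

lemma truncated_expansion_generic:
  fixes s :: int and x1 x2 x3 l :: complex and N :: nat
  defines "q \<equiv> pole_quadratic s x1 x2 x3 l"
  defines "u \<equiv> \<lambda>k::nat. cubic x1 x2 x3 (- of_nat k) / (l + of_nat k)"
  assumes sum: "x1 + x2 + x3 = of_int s"
    and l: "\<And>k. k < N \<Longrightarrow> l + of_nat k \<noteq> 0"
    and x: "\<And>k. k < N \<Longrightarrow> cubic x1 x2 x3 (- of_nat k) \<noteq> 0"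
    and inj: "inj_on u {..<N}"
    and simple: "\<And>k. k < N \<Longrightarrow> q k (- of_nat k) \<noteq> 0"
  shows "(\<And>j k. j < N \<Longrightarrow> k < N \<Longrightarrow> q k (- of_nat j) \<noteq> 0)"
    and "(\<Prod>j<N. cubic x1 x2 x3 (of_nat (Suc j)) / (- cubic x1 x2 x3 (- of_nat j))) =
       (\<Prod>j<N. (of_nat (Suc j) - l) / (l + of_nat j)) +
       (\<Sum>k<N. (\<Prod>j<N. of_nat (Suc j) + of_nat k) / (\<Prod>j\<in>{..<N}-{k}. of_nat j - of_nat k) *
          reciprocal_term x1 x2 x3 l k *
          ((\<Prod>j<N. q k (of_nat (Suc j))) / (\<Prod>j<N. q k (- of_nat j))))"
proof -
  define P where "P = cubic x1 x2 x3"
  have pencil: "P t + (t - l) * u k = (t + of_nat k) * q k t" if "k < N" for k t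
    unfolding P_def u_def q_def by (rule cubic_pencil_factor[OF sum l[OF that]])
  have u0: "u k \<noteq> 0" if "k < N" for k
    using l[OF that] x[OF that] by (simp add: u_def)
  have lu: "(l + of_nat k) * u k = P (- of_nat k)" if "k < N" for k
    using l[OF that] by (simp add: u_def P_def)
  have udiff: "(l + of_nat j) * (u k - u j) = (of_nat j - of_nat k) * q k (- of_nat j)"
    if "j < N" "k < N" for j k
  proof -
    have "(l + of_nat j) * (u k - u j) = - (P (- of_nat j) + (- of_nat j - l) * u k)"
      unfolding right_diff_distrib lu[OF that(1)] by (simp add: algebra_simps)
    then show ?thesis unfolding pencil[OF that(2)] by (simp add: algebra_simps)
  qed
  show nz: "q k (- of_nat j) \<noteq> 0" if "j < N" "k < N" for j k
  proof (cases "j = k")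
    case True
    then show ?thesis using simple that by simp
  next
    case False
    then have "u k \<noteq> u j" using inj that by (auto simp: inj_on_def)
    then show ?thesis using udiff[OF that] l[OF that(1)] by auto
  qed
  have recip: "reciprocal_term x1 x2 x3 l k = - q k (- of_nat k) / P (- of_nat k)" if "k < N" for k
  proof -
    have "x1 + of_nat k \<noteq> 0" "x2 + of_nat k \<noteq> 0" "x3 + of_nat k \<noteq> 0"
      using x[OF that] by (auto simp: cubic_def add_eq_0_iff)
    from pole_quadratic_at_pole[OF sum l[OF that] this] show ?thesis
      using x[OF that] by (simp add: q_def P_def field_simps)
  qed
  define L where "L = (\<Prod>j<N. l + of_nat j)"
  have L0: "L \<noteq> 0" using l by (auto simp: L_def)
  have pf: "(\<Prod>j<N. (P (of_nat (Suc j)) + (of_nat (Suc j) - l) * 0) / (0 - u j)) =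
     (\<Prod>j<N. of_nat (Suc j) - l) +
     (\<Sum>k<N. (\<Prod>j<N. P (of_nat (Suc j)) + (of_nat (Suc j) - l) * u k) /
              (\<Prod>j\<in>{..<N}-{k}. u k - u j) / (0 - u k))"
    by (rule partial_fractions_product[OF inj]) (use u0 in force)
  have lhs: "(\<Prod>j<N. (P (of_nat (Suc j)) + (of_nat (Suc j) - l) * 0) / (0 - u j)) / L =
     (\<Prod>j<N. P (of_nat (Suc j)) / (- P (- of_nat j)))"
    unfolding L_def prod_dividef[symmetric]
    by (intro prod.cong refl) (simp add: lu[symmetric] mult.commute)
  have summand: "(\<Prod>j<N. P (of_nat (Suc j)) + (of_nat (Suc j) - l) * u k) /
              (\<Prod>j\<in>{..<N}-{k}. u k - u j) / (0 - u k) / L =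
       (\<Prod>j<N. of_nat (Suc j) + of_nat k) / (\<Prod>j\<in>{..<N}-{k}. of_nat j - of_nat k) *
          reciprocal_term x1 x2 x3 l k *
          ((\<Prod>j<N. q k (of_nat (Suc j))) / (\<Prod>j<N. q k (- of_nat j)))" if k: "k < N" for k
  proof -
    let ?J = "{..<N}-{k}"
    have "L = (l + of_nat k) * (\<Prod>j\<in>?J. l + of_nat j)"
      unfolding L_def using k by (subst prod.remove[of _ k]) auto
    then have "(\<Prod>j\<in>?J. u k - u j) * (0 - u k) * L =
        (\<Prod>j\<in>?J. (l + of_nat j) * (u k - u j)) * - ((l + of_nat k) * u k)"
      by (simp add: prod.distrib)
    also have "\<dots> = (\<Prod>j\<in>?J. of_nat j - of_nat k) * (\<Prod>j\<in>?J. q k (- of_nat j)) * - P (- of_nat k)"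
      unfolding lu[OF k] by (simp add: udiff[OF _ k] prod.distrib)
    finally have den: "(\<Prod>j\<in>?J. u k - u j) * (0 - u k) * L =
      (\<Prod>j\<in>?J. of_nat j - of_nat k) * (\<Prod>j\<in>?J. q k (- of_nat j)) * - P (- of_nat k)" .
    have num: "(\<Prod>j<N. P (of_nat (Suc j)) + (of_nat (Suc j) - l) * u k) =
       (\<Prod>j<N. of_nat (Suc j) + of_nat k) * (\<Prod>j<N. q k (of_nat (Suc j)))"
      unfolding pencil[OF k] by (rule prod.distrib)
    have full: "(\<Prod>j<N. q k (- of_nat j)) = q k (- of_nat k) * (\<Prod>j\<in>?J. q k (- of_nat j))"
      using k by (subst prod.remove[of _ k]) auto
    show ?thesis
      unfolding divide_divide_eq_left den num full recip[OF k]
      using nz[OF k k] by simp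
  qed
  have "(\<Prod>j<N. P (of_nat (Suc j)) / (- P (- of_nat j))) =
    (\<Prod>j<N. of_nat (Suc j) - l) / L +
     (\<Sum>k<N. (\<Prod>j<N. P (of_nat (Suc j)) + (of_nat (Suc j) - l) * u k) /
              (\<Prod>j\<in>{..<N}-{k}. u k - u j) / (0 - u k) / L)"
    using arg_cong[OF pf, of "\<lambda>z. z / L"] unfolding lhs
    by (simp only: add_divide_distrib sum_divide_distrib)
  also have "(\<Sum>k<N. (\<Prod>j<N. P (of_nat (Suc j)) + (of_nat (Suc j) - l) * u k) /
              (\<Prod>j\<in>{..<N}-{k}. u k - u j) / (0 - u k) / L) =
     (\<Sum>k<N. (\<Prod>j<N. of_nat (Suc j) + of_nat k) / (\<Prod>j\<in>{..<N}-{k}. of_nat j - of_nat k) *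
          reciprocal_term x1 x2 x3 l k *
          ((\<Prod>j<N. q k (of_nat (Suc j))) / (\<Prod>j<N. q k (- of_nat j))))"
    by (intro sum.cong refl summand) auto
  also have "(\<Prod>j<N. of_nat (Suc j) - l) / L = (\<Prod>j<N. (of_nat (Suc j) - l) / (l + of_nat j))"
    unfolding L_def prod_dividef ..
  finally show "(\<Prod>j<N. cubic x1 x2 x3 (of_nat (Suc j)) / (- cubic x1 x2 x3 (- of_nat j))) =
       (\<Prod>j<N. (of_nat (Suc j) - l) / (l + of_nat j)) +
       (\<Sum>k<N. (\<Prod>j<N. of_nat (Suc j) + of_nat k) / (\<Prod>j\<in>{..<N}-{k}. of_nat j - of_nat k) *
          reciprocal_term x1 x2 x3 l k *
          ((\<Prod>j<N. q k (of_nat (Suc j))) / (\<Prod>j<N. q k (- of_nat j))))"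
    unfolding P_def .
qed

text \<open>The convention for negative \<open>m\<close> is that of Pochhammer symbols and makes the value equal to
  \<open>F (n + m) / F n\<close> for any nowhere vanishing \<open>F\<close> with \<open>F i = f i * F (i - 1)\<close>.\<close>

definition shift_prod :: "(int \<Rightarrow> 'a::field) \<Rightarrow> int \<Rightarrow> int \<Rightarrow> 'a" where
  "shift_prod f n m = (if m \<ge> 0 then \<Prod>i = n+1..n+m. f i else inverse (\<Prod>i = n+m+1..n. f i))"

lemma prod_int_interval_split:
  fixes f :: "int \<Rightarrow> 'a::comm_monoid_mult"
  assumes "a \<le> b + 1" and "b \<le> c"
  shows "(\<Prod>i = a..c. f i) = (\<Prod>i = a..b. f i) * (\<Prod>i = b+1..c. f i)"
proof -
  have "{a..c} = {a..b} \<union> {b+1..c}" using assms by auto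
  then show ?thesis by (simp add: prod.union_disjoint)
qed

text \<open>Two windows of length \<open>n\<close>, one shifted by \<open>m\<close>: the overlap cancels. The right-hand side stays
  meaningful when a factor of the overlap vanishes.\<close>

lemma shift_prod_ratio:
  fixes f :: "int \<Rightarrow> 'a::field"
  assumes n: "n \<ge> 0"
    and B: "(\<Prod>i = m+1..m+n. f i) \<noteq> 0"
    and D: "m \<ge> 0 \<Longrightarrow> (\<Prod>i = n+1..n+m. f i) \<noteq> 0"
    and W: "m < 0 \<Longrightarrow> (\<Prod>i = m+1..0. f i) \<noteq> 0"
  shows "(\<Prod>i = 1..n. f i) / (\<Prod>i = m+1..m+n. f i) = shift_prod f 0 m / shift_prod f n m"
proof (cases "m \<ge> 0")
  case True
  have "(\<Prod>i = 1..m+n. f i) = (\<Prod>i = 1..m. f i) * (\<Prod>i = m+1..m+n. f i)"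
    by (rule prod_int_interval_split) (use True n in auto)
  moreover have "(\<Prod>i = 1..n+m. f i) = (\<Prod>i = 1..n. f i) * (\<Prod>i = n+1..n+m. f i)"
    by (rule prod_int_interval_split) (use True n in auto)
  ultimately show ?thesis
    using True B D[OF True] by (simp add: shift_prod_def frac_eq_eq add.commute)
next
  case False
  have "(\<Prod>i = m+1..n. f i) = (\<Prod>i = m+1..0. f i) * (\<Prod>i = 0+1..n. f i)"
    by (rule prod_int_interval_split) (use False n in auto)
  moreover have "(\<Prod>i = m+1..n. f i) = (\<Prod>i = m+1..m+n. f i) * (\<Prod>i = m+n+1..n. f i)"
    by (rule prod_int_interval_split) (use False n in auto)
  moreover have "(\<Prod>i = m+1..0. f i) \<noteq> 0" using False W by auto
  ultimately show ?thesis
    using False B by (simp add: shift_prod_def field_simps add.commute)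
qed

lemma tendsto_shift_prod:
  fixes f :: "'b \<Rightarrow> int \<Rightarrow> 'a::{real_normed_field}"
  assumes "\<And>i. ((\<lambda>z. f z i) \<longlongrightarrow> g i) F"
    and "m < 0 \<Longrightarrow> (\<Prod>i = n+m+1..n. g i) \<noteq> 0"
  shows "((\<lambda>z. shift_prod (f z) n m) \<longlongrightarrow> shift_prod g n m) F"
  using assms unfolding shift_prod_def
  by (cases "m \<ge> 0") (auto intro!: tendsto_prod tendsto_inverse)

lemma shift_prod_eq_0_iff:
  "shift_prod f n m = 0 \<longleftrightarrow> (if m \<ge> 0 then (\<Prod>i = n+1..n+m. f i) = 0 else (\<Prod>i = n+m+1..n. f i) = 0)"
  by (simp add: shift_prod_def)

lemma eventually_linear_neq:
  fixes a b p q l :: complex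
  assumes "a \<noteq> 0" and "p \<noteq> q"
  shows "eventually (\<lambda>z. a * (z + p) \<noteq> b * (z + q)) (at l)"
proof (cases "a = b")
  case True
  then show ?thesis using assms by simp
next
  case False
  have "eventually (\<lambda>z. z \<noteq> (b * q - a * p) / (a - b)) (at l)"
    by (rule eventually_neq_at_within)
  then show ?thesis
  proof eventually_elim
    case (elim z)
    show ?case
    proof
      assume "a * (z + p) = b * (z + q)"
      then have "z * (a - b) = b * q - a * p" by algebra
      then have "z = (b * q - a * p) / (a - b)" using False by (simp add: field_simps)
      then show False using elim by simp
    qed
  qed
qed

lemma tendsto_pole_quadratic:
  assumes "l + of_nat k \<noteq> 0"
  shows "((\<lambda>z. pole_quadratic s x1 x2 x3 z k t) \<longlongrightarrow> pole_quadratic s x1 x2 x3 l k t) (at l)"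
  unfolding pole_quadratic_def xi_radicand_def
  by (intro tendsto_intros) (use assms in auto)

text \<open>Two poles \<open>u j\<close> and \<open>u k\<close> may coincide, and then the residues above are meaningless, but
  the cancelled form of the summands is not. Coincidence is an exceptional condition on \<open>l\<close>, since it
  says \<open>P(-k) (l + j) = P(-j) (l + k)\<close> with both values of \<open>P\<close> nonzero; a double
  root at \<open>- k\<close> is exceptional too. Both sides are continuous
  in \<open>l\<close>, so the identity extends from a punctured neighbourhood to \<open>l\<close> itself.\<close>

lemma truncated_expansion:
  fixes s :: int and x1 x2 x3 l :: complex and N :: nat
  defines "f \<equiv> \<lambda>l k (i::int). pole_quadratic s x1 x2 x3 l k (of_int i)"
  defines "m \<equiv> \<lambda>k::nat. int k + s - 1"
  assumes sum: "x1 + x2 + x3 = of_int s"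
    and l: "\<And>k. k < N \<Longrightarrow> l + of_nat k \<noteq> 0"
    and x: "\<And>k. k < N \<Longrightarrow> cubic x1 x2 x3 (- of_nat k) \<noteq> 0"
    and W: "\<And>k. k < N \<Longrightarrow> m k < 0 \<Longrightarrow> (\<Prod>i = m k + 1..0. f l k i) \<noteq> 0"
    and D: "\<And>k. k < N \<Longrightarrow> shift_prod (f l k) (int N) (m k) \<noteq> 0"
  shows "(\<Prod>j<N. cubic x1 x2 x3 (of_nat (Suc j)) / (- cubic x1 x2 x3 (- of_nat j))) =
       (\<Prod>j<N. (of_nat (Suc j) - l) / (l + of_nat j)) +
       (\<Sum>k<N. (\<Prod>j<N. of_nat (Suc j) + of_nat k) / (\<Prod>j\<in>{..<N}-{k}. of_nat j - of_nat k) *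
          reciprocal_term x1 x2 x3 l k *
          (shift_prod (f l k) 0 (m k) / shift_prod (f l k) (int N) (m k)))"
    (is "?lhs = ?rhs l")
proof -
  have f_tendsto: "((\<lambda>z. f z k i) \<longlongrightarrow> f l k i) (at l)" if "k < N" for k i
    unfolding f_def by (rule tendsto_pole_quadratic[OF l[OF that]])
  have D': "(\<Prod>i = int N + m k + 1..int N. f l k i) \<noteq> 0" if "k < N" "m k < 0" for k
    using D[OF that(1)] that(2) by (simp add: shift_prod_eq_0_iff split: if_splits)
  have sp_N: "((\<lambda>z. shift_prod (f z k) (int N) (m k)) \<longlongrightarrow> shift_prod (f l k) (int N) (m k)) (at l)"
    if "k < N" for k
    by (rule tendsto_shift_prod) (use f_tendsto[OF that] D'[OF that] in auto)
  have sp_0: "((\<lambda>z. shift_prod (f z k) 0 (m k)) \<longlongrightarrow> shift_prod (f l k) 0 (m k)) (at l)"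
    if "k < N" for k
    by (rule tendsto_shift_prod) (use f_tendsto[OF that] W[OF that] in auto)
  have W_tendsto: "((\<lambda>z. \<Prod>i = m k + 1..0. f z k i) \<longlongrightarrow> (\<Prod>i = m k + 1..0. f l k i)) (at l)"
    if "k < N" for k
    by (intro tendsto_prod f_tendsto that)
  have rhs: "(?rhs \<longlongrightarrow> ?rhs l) (at l)"
    unfolding reciprocal_term_def
    by (intro tendsto_add tendsto_prod tendsto_divide tendsto_sum tendsto_mult tendsto_diff
          tendsto_const tendsto_ident_at sp_N sp_0)
       (use l D in auto)
  \<comment> \<open>the values of \<open>z\<close> at which the poles are distinct and simple and no denominator vanishes\<close>
  define good where "good = (\<lambda>z. \<forall>k<N. z + of_nat k \<noteq> 0 \<and>
     (m k < 0 \<longrightarrow> (\<Prod>i = m k + 1..0. f z k i) \<noteq> 0) \<and>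
     shift_prod (f z k) (int N) (m k) \<noteq> 0 \<and> reciprocal_term x1 x2 x3 z k \<noteq> 0 \<and>
     (\<forall>j<N. j \<noteq> k \<longrightarrow> cubic x1 x2 x3 (- of_nat k) * (z + of_nat j) \<noteq>
                      cubic x1 x2 x3 (- of_nat j) * (z + of_nat k)))"
  have all_lt: "eventually (\<lambda>z. \<forall>k<N. Q z k) (at l)"
    if "\<And>k. k < N \<Longrightarrow> eventually (\<lambda>z. Q z k) (at l)" for Q
  proof -
    have "eventually (\<lambda>z. \<forall>k\<in>{..<N}. Q z k) (at l)"
      by (rule eventually_ball_finite) (use that in auto)
    then show ?thesis by (rule eventually_mono) auto
  qed
  have shift_neq: "eventually (\<lambda>z. z + of_nat k \<noteq> 0) (at l)" if "k < N" for k
    by (rule tendsto_imp_eventually_ne[OF _ l[OF that]]) (intro tendsto_intros)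
  have "eventually good (at l)"
    unfolding good_def
  proof (intro all_lt eventually_conj)
    fix k assume k: "k < N"
    show "eventually (\<lambda>z. z + of_nat k \<noteq> 0) (at l)" by (rule shift_neq[OF k])
    show "eventually (\<lambda>z. m k < 0 \<longrightarrow> (\<Prod>i = m k + 1..0. f z k i) \<noteq> 0) (at l)"
      using tendsto_imp_eventually_ne[OF W_tendsto[OF k] W[OF k]] by (cases "m k < 0") auto
    show "eventually (\<lambda>z. shift_prod (f z k) (int N) (m k) \<noteq> 0) (at l)"
      by (rule tendsto_imp_eventually_ne[OF sp_N[OF k] D[OF k]])
    show "eventually (\<lambda>z. reciprocal_term x1 x2 x3 z k \<noteq> 0) (at l)"
    proof -
      define S where "S = 1 / (x1 + of_nat k) + 1 / (x2 + of_nat k) + 1 / (x3 + of_nat k)"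
      have "eventually (\<lambda>z. z \<noteq> 1 / S - of_nat k) (at l)" by (rule eventually_neq_at_within)
      with shift_neq[OF k] show ?thesis
      proof eventually_elim
        case (elim z)
        have "S \<noteq> 1 / (z + of_nat k)"
        proof
          assume "S = 1 / (z + of_nat k)"
          then have "z = 1 / S - of_nat k" using elim(1) by simp
          then show False using elim(2) by simp
        qed
        then show ?case by (simp add: reciprocal_term_def S_def)
      qed
    qed
    fix j assume j: "j < N"
    show "eventually (\<lambda>z. j \<noteq> k \<longrightarrow> cubic x1 x2 x3 (- of_nat k) * (z + of_nat j) \<noteq>
                      cubic x1 x2 x3 (- of_nat j) * (z + of_nat k)) (at l)"
    proof (cases "j = k")
      case False
      then show ?thesis using eventually_linear_neq[OF x[OF k], of "of_nat j" "of_nat k"] by simp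
    qed simp
  qed
  moreover have "?rhs z = ?lhs" if "good z" for z
  proof -
    have lz: "z + of_nat k \<noteq> 0" if "k < N" for k using \<open>good z\<close> that by (auto simp: good_def)
    define u where "u = (\<lambda>k::nat. cubic x1 x2 x3 (- of_nat k) / (z + of_nat k))"
    have inj: "inj_on u {..<N}"
    proof (rule inj_onI)
      fix k j assume kj: "k \<in> {..<N}" "j \<in> {..<N}" "u k = u j"
      then have "cubic x1 x2 x3 (- of_nat k) * (z + of_nat j) =
                 cubic x1 x2 x3 (- of_nat j) * (z + of_nat k)"
        using lz[of k] lz[of j] by (simp add: u_def frac_eq_eq)
      then show "k = j" using \<open>good z\<close> kj by (auto simp: good_def)
    qed
    have simple: "pole_quadratic s x1 x2 x3 z k (- of_nat k) \<noteq> 0" if k: "k < N" for k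
    proof -
      have "x1 + of_nat k \<noteq> 0" "x2 + of_nat k \<noteq> 0" "x3 + of_nat k \<noteq> 0"
        using x[OF k] by (auto simp: cubic_def add_eq_0_iff)
      from pole_quadratic_at_pole[OF sum lz[OF k] this]
      show ?thesis using x[OF k] \<open>good z\<close> k by (simp add: good_def)
    qed
    note gen = truncated_expansion_generic[OF sum lz x inj[unfolded u_def] simple]
    have ratio: "(\<Prod>j<N. pole_quadratic s x1 x2 x3 z k (of_nat (Suc j))) /
          (\<Prod>j<N. pole_quadratic s x1 x2 x3 z k (- of_nat j)) =
        shift_prod (f z k) 0 (m k) / shift_prod (f z k) (int N) (m k)" if k: "k < N" for k
    proof -
      have A: "(\<Prod>j<N. pole_quadratic s x1 x2 x3 z k (of_nat (Suc j))) = (\<Prod>i = 1..int N. f z k i)"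
        by (rule prod.reindex_bij_witness[of _ "\<lambda>i. nat (i - 1)" "\<lambda>j. int (Suc j)"])
           (auto simp: f_def)
      have B: "(\<Prod>j<N. pole_quadratic s x1 x2 x3 z k (- of_nat j)) =
           (\<Prod>i = m k + 1..m k + int N. f z k i)"
      proof (rule prod.reindex_bij_witness[of _ "\<lambda>i. nat (i - (m k + 1))" "\<lambda>j. m k + 1 + int j"])
        fix j assume "j \<in> {..<N}"
        show "f z k (m k + 1 + int j) = pole_quadratic s x1 x2 x3 z k (- of_nat j)"
          using pole_quadratic_reflect[of s x1 x2 x3 z k "- of_nat j"]
          by (simp add: f_def m_def algebra_simps)
      qed auto
      show ?thesis unfolding A B
      proof (rule shift_prod_ratio)
        show "(\<Prod>i = m k + 1..m k + int N. f z k i) \<noteq> 0"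
          unfolding B[symmetric] using gen(1) k by simp
        show "(\<Prod>i = int N + 1..int N + m k. f z k i) \<noteq> 0" if "m k \<ge> 0"
        proof -
          have "shift_prod (f z k) (int N) (m k) \<noteq> 0" using \<open>good z\<close> k by (auto simp: good_def)
          then show ?thesis using that by (simp add: shift_prod_def)
        qed
      qed (use \<open>good z\<close> k in \<open>auto simp: good_def\<close>)
    qed
    show ?thesis
      by (rule trans[OF _ gen(2)[symmetric]])
         (auto intro!: sum.cong simp: ratio simp del: of_nat_Suc)
  qed
  ultimately have "eventually (\<lambda>z. ?rhs z = ?lhs) (at l)" by (auto elim: eventually_mono)
  then have "(?rhs \<longlongrightarrow> ?lhs) (at l)" by (rule tendsto_eventually)
  from tendsto_unique[OF _ this rhs] show ?thesis by simp
qed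

section \<open>Identification of the coefficients and of the limits\<close>

lemma fact_add_eq_prod_squares:
  assumes "k < N"
  shows "(fact (N + k) :: 'a::field_char_0) =
           fact (N - 1 - k) * of_nat N * (\<Prod>j = 1..k. (of_nat N)\<^sup>2 - (of_nat j)\<^sup>2)"
  using assms
proof (induction k)
  case 0
  then show ?case by (cases N) (simp_all add: mult.commute)
next
  case (Suc k)
  obtain d where N: "N = Suc (Suc (k + d))" using Suc.prems by (metis less_iff_Suc_add add_Suc)
  have IH: "(fact (N + k) :: 'a) =
      fact (N - 1 - k) * of_nat N * (\<Prod>j = 1..k. (of_nat N)\<^sup>2 - (of_nat j)\<^sup>2)"
    using Suc by simp
  have d: "N - 1 - k = Suc d" "N - 1 - Suc k = d" using N by auto
  have "(fact (N + Suc k) :: 'a) = (of_nat N + of_nat (Suc k)) * fact (N + k)" by simp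
  also have "\<dots> = fact d * of_nat N * (\<Prod>j = 1..k. (of_nat N)\<^sup>2 - (of_nat j)\<^sup>2) *
      ((of_nat N + of_nat (Suc k)) * of_nat (Suc d))"
    unfolding IH d by (simp add: mult_ac)
  also have "(of_nat N + of_nat (Suc k)) * of_nat (Suc d) = (of_nat N)\<^sup>2 - (of_nat (Suc k) :: 'a)\<^sup>2"
    unfolding N by (simp add: power2_eq_square algebra_simps)
  finally show ?case unfolding d by (simp add: mult_ac)
qed

lemma truncation_coefficient:
  assumes "k < N"
  shows "(\<Prod>j<N. of_nat (Suc j) + of_nat k) / (\<Prod>j\<in>{..<N}-{k}. of_nat j - of_nat k) =
      ((-1) ^ k / (fact k)\<^sup>2 * (of_nat N * (\<Prod>j = 1..k. (of_nat N)\<^sup>2 - (of_nat j)\<^sup>2)) :: 'a::field_char_0)"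
proof -
  have num: "fact k * (\<Prod>j<N. of_nat (Suc j) + of_nat k) = (fact (N + k) :: 'a)"
  proof (induction N)
    case (Suc N)
    have "fact k * (\<Prod>j<Suc N. of_nat (Suc j) + of_nat k) =
        (of_nat (Suc N) + of_nat k) * (fact k * (\<Prod>j<N. of_nat (Suc j) + of_nat k) :: 'a)"
      by (simp add: mult_ac)
    also have "\<dots> = fact (Suc N + k)" unfolding Suc.IH by simp
    finally show ?case .
  qed simp
  have set: "{..<N}-{k} = {..<k} \<union> {Suc k..<N}" using assms by auto
  have "(\<Prod>j<k. of_nat j - of_nat k :: 'a) = (\<Prod>j<k. - of_nat (k - j))"
    by (intro prod.cong refl) (simp add: of_nat_diff)
  also have "\<dots> = (-1) ^ k * (\<Prod>j<k. of_nat (k - j))"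
    by (subst prod_uminus) simp
  also have "(\<Prod>j<k. of_nat (k - j) :: 'a) = fact k"
    by (simp add: fact_prod_rev atLeast0LessThan)
  finally have lower: "(\<Prod>j<k. of_nat j - of_nat k :: 'a) = (-1) ^ k * fact k" .
  have "(\<Prod>j\<in>{Suc k..<N}. of_nat j - of_nat k :: 'a) = (\<Prod>j\<in>{1..N - 1 - k}. of_nat j)"
    by (rule prod.reindex_bij_witness[of _ "\<lambda>j. j + k" "\<lambda>j. j - k"]) (auto simp: of_nat_diff)
  then have upper: "(\<Prod>j\<in>{Suc k..<N}. of_nat j - of_nat k :: 'a) = fact (N - 1 - k)"
    by (simp add: fact_prod)
  have den: "(\<Prod>j\<in>{..<N}-{k}. of_nat j - of_nat k :: 'a) = (-1) ^ k * fact k * fact (N - 1 - k)"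
    unfolding set by (subst prod.union_disjoint) (auto simp: lower upper)
  have num': "(\<Prod>j<N. of_nat (Suc j) + of_nat k) = (fact (N + k) / fact k :: 'a)"
    using num by (simp add: field_simps)
  have sq: "(-1) ^ k * ((-1) ^ k * (z :: 'a)) = z" for z
    by (metis mult.assoc mult_1 power2_eq_square power_minus1_even power_mult mult.commute power_mult_distrib)
  show ?thesis
    unfolding num' den fact_add_eq_prod_squares[OF assms]
    by (simp add: field_simps power2_eq_square sq)
qed

text \<open>The shifts are symmetric about \<open>0\<close>, so reversing the order of one of the two products
  pairs \<open>r + c\<close> with \<open>r - c\<close>.\<close>

lemma centered_product_square:
  fixes r :: "'a::field_char_0"
  shows "(\<Prod>j<n. r + (of_nat j - (of_nat n - 1) / 2))\<^sup>2 =
           (-1) ^ n * (\<Prod>j<n. (of_nat j - (of_nat n - 1) / 2)\<^sup>2 - r\<^sup>2)"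
proof -
  define c :: "nat \<Rightarrow> 'a" where "c = (\<lambda>j. of_nat j - (of_nat n - 1) / 2)"
  have "(\<Prod>j<n. r + c j) = (\<Prod>j<n. r + c (n - Suc j))"
    by (rule prod.nat_diff_reindex[symmetric])
  also have "\<dots> = (\<Prod>j<n. r - c j)"
    by (intro prod.cong refl) (auto simp: c_def of_nat_diff field_simps)
  finally have "(\<Prod>j<n. r + c j)\<^sup>2 = (\<Prod>j<n. (r + c j) * (r - c j))"
    by (simp add: power2_eq_square prod.distrib)
  also have "\<dots> = (\<Prod>j<n. - ((c j)\<^sup>2 - r\<^sup>2))"
    by (intro prod.cong refl) (simp add: power2_eq_square algebra_simps)
  also have "\<dots> = (-1) ^ n * (\<Prod>j<n. (c j)\<^sup>2 - r\<^sup>2)" by (subst prod_uminus) simp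
  finally show ?thesis unfolding c_def .
qed

text \<open>The factors of \<open>(\<xi>)\<^sub>m\<close> are \<open>r\<close> plus shifts symmetric about \<open>0\<close>, because
  \<open>\<xi> = (1 - m) / 2 + r\<close>. This is also why the sign of the square root does not matter.\<close>

lemma shift_prod_eq_int_pochhammer_square:
  fixes s :: int and k :: nat
  defines "m \<equiv> int k + s - 1"
  assumes r: "r\<^sup>2 = xi_radicand s x1 x2 x3 l k"
  shows "shift_prod (\<lambda>i. pole_quadratic s x1 x2 x3 l k (of_int i)) 0 m =
           (-1) powi m * (int_pochhammer (xi s k r) m)\<^sup>2"
proof (cases "m \<ge> 0")
  case True
  define n where "n = nat m"
  have m: "m = int n" using True by (simp add: n_def)
  have sk: "(of_int s + of_nat k :: complex) = of_nat n + 1"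
    using arg_cong[OF m[unfolded m_def], of "of_int :: int \<Rightarrow> complex"] by (simp add: algebra_simps)
  have xi: "xi s k r = r - (of_nat n - 1) / 2"
    unfolding xi_def diff_diff_eq sk by (simp add: field_simps)
  have "(\<Prod>i = 0+1..0+m. pole_quadratic s x1 x2 x3 l k (of_int i)) =
      (\<Prod>j<n. (of_nat j - (of_nat n - 1) / 2)\<^sup>2 - r\<^sup>2)"
    by (rule prod.reindex_bij_witness[of _ "\<lambda>j. int (Suc j)" "\<lambda>i. nat (i - 1)"])
       (auto simp: m pole_quadratic_def r sk of_nat_nat field_simps)
  moreover have "int_pochhammer (xi s k r) m = (\<Prod>j<n. r + (of_nat j - (of_nat n - 1) / 2))"
    using True by (simp add: int_pochhammer_def m pochhammer_prod xi atLeast0LessThan algebra_simps)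
  ultimately show ?thesis
    using True centered_product_square[of r n]
    by (simp add: shift_prod_def m mult.assoc[symmetric] power_mult_distrib[symmetric])
next
  case False
  define n where "n = nat (- m)"
  have m: "m = - int n" using False by (simp add: n_def)
  have sk: "(of_int s + of_nat k :: complex) = 1 - of_nat n"
    using arg_cong[OF m[unfolded m_def], of "of_int :: int \<Rightarrow> complex"] by (simp add: algebra_simps)
  have xi: "xi s k r = r + (of_nat n + 1) / 2"
    unfolding xi_def diff_diff_eq sk by (simp add: field_simps)
  have A: "(\<Prod>i = 0+m+1..0. pole_quadratic s x1 x2 x3 l k (of_int i)) =
      (\<Prod>j<n. (of_nat j - (of_nat n - 1) / 2)\<^sup>2 - r\<^sup>2)"
    by (rule prod.reindex_bij_witness[of _ "\<lambda>j. int j - int n + 1" "\<lambda>i. nat (i + int n - 1)"])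
       (auto simp: m pole_quadratic_def r sk of_nat_nat field_simps)
  have B: "(\<Prod>j = 1..n. xi s k r - of_nat j) = (\<Prod>j<n. r + (of_nat j - (of_nat n - 1) / 2))"
    by (rule prod.reindex_bij_witness[of _ "\<lambda>j. n - j" "\<lambda>i. n - i"])
       (auto simp: xi of_nat_diff field_simps)
  have sgn: "(-1) powi m = ((-1) ^ n :: complex)"
    unfolding m by (simp add: power_int_minus power_int_of_nat flip: power_inverse)
  have "shift_prod (\<lambda>i. pole_quadratic s x1 x2 x3 l k (of_int i)) 0 m =
      inverse (\<Prod>j<n. (of_nat j - (of_nat n - 1) / 2)\<^sup>2 - r\<^sup>2)"
    using False unfolding A[symmetric] by (simp add: shift_prod_def)
  moreover have "(int_pochhammer (xi s k r) m)\<^sup>2 =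
      inverse ((-1) ^ n * (\<Prod>j<n. (of_nat j - (of_nat n - 1) / 2)\<^sup>2 - r\<^sup>2))"
    using False unfolding centered_product_square[symmetric] B[symmetric] int_pochhammer_def n_def[symmetric]
    by (simp add: power_inverse)
  ultimately show ?thesis
    unfolding sgn by (cases "even n") simp_all
qed

lemma pochhammer_rGamma_LIMSEQ:
  fixes z :: complex
  shows "(\<lambda>N. pochhammer z N / (fact (N - 1) * exp (z * of_real (ln (of_nat N))))) \<longlonglongrightarrow> rGamma z"
proof -
  have "(\<lambda>N. 1 / (1 + z * (1 / of_nat N))) \<longlonglongrightarrow> 1 / (1 + z * 0)"
    by (intro tendsto_intros lim_1_over_n) auto
  then have "(\<lambda>N. rGamma_series z N * (1 / (1 + z * (1 / of_nat N)))) \<longlonglongrightarrow> rGamma z * 1"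
    by (intro tendsto_mult rGamma_series_LIMSEQ) simp
  moreover have "eventually (\<lambda>N. rGamma_series z N * (1 / (1 + z * (1 / of_nat N))) =
      pochhammer z N / (fact (N - 1) * exp (z * of_real (ln (of_nat N))))) sequentially"
    using eventually_gt_at_top[of "nat \<lceil>norm z\<rceil>"]
  proof eventually_elim
    case (elim N)
    then have N: "N > 0" "norm z < of_nat N" by linarith+
    have "z + of_nat N \<noteq> 0"
      using N by (metis add_eq_0_iff norm_minus_cancel norm_of_nat less_irrefl)
    moreover have "(fact N :: complex) = of_nat N * fact (N - 1)"
      using N by (simp add: fact_reduce)
    ultimately show ?case using N
      by (simp add: rGamma_series_def pochhammer_rec' divide_simps) (simp add: algebra_simps)
  qed
  ultimately show ?thesis by (simp add: tendsto_cong)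
qed

text \<open>Euler's limit formula for \<open>z\<close> and for \<open>1 - z\<close>; the factorials cancel.\<close>

lemma pochhammer_ratio_LIMSEQ:
  fixes z :: complex
  assumes "z \<notin> \<int>\<^sub>\<le>\<^sub>0"
  shows "(\<lambda>N. exp ((2 * z - 1) * of_real (ln (of_nat N))) * (pochhammer (1 - z) N / pochhammer z N))
           \<longlonglongrightarrow> Gamma z * rGamma (1 - z)"
proof -
  let ?L = "\<lambda>N::nat. complex_of_real (ln (of_nat N))"
  have "(\<lambda>N. (pochhammer (1 - z) N / (fact (N - 1) * exp ((1 - z) * ?L N))) /
      (pochhammer z N / (fact (N - 1) * exp (z * ?L N)))) \<longlonglongrightarrow> rGamma (1 - z) / rGamma z"
    by (intro tendsto_divide pochhammer_rGamma_LIMSEQ) (use assms in \<open>auto simp: rGamma_eq_zero_iff\<close>)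
  moreover have "(pochhammer (1 - z) N / (fact (N - 1) * exp ((1 - z) * ?L N))) /
      (pochhammer z N / (fact (N - 1) * exp (z * ?L N))) =
      exp ((2 * z - 1) * ?L N) * (pochhammer (1 - z) N / pochhammer z N)" for N
  proof -
    have "(2 * z - 1) * ?L N = z * ?L N - (1 - z) * ?L N" by (simp add: algebra_simps)
    then show ?thesis by (simp add: exp_diff)
  qed
  ultimately show ?thesis by (simp add: rGamma_inverse_Gamma field_simps)
qed

section \<open>Uniform bounds\<close>

text \<open>With \<open>h = (s + k) / 2 - l\<close> the roots are \<open>(s + k) / 2\<close> plus or minus \<open>r\<close>, where
  \<open>r\<^sup>2 - h\<^sup>2\<close> tends to \<open>0\<close>. Choosing the sign for which \<open>r\<close> is closer to \<open>h\<close>, the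
  error \<open>h - r\<close> has square at most \<open>\<bar>r\<^sup>2 - h\<^sup>2\<bar>\<close> in modulus. This crude rate is enough.\<close>

lemma pole_quadratic_roots:
  fixes s :: int and x1 x2 x3 l :: complex
  shows "\<exists>e. e \<longlonglongrightarrow> 0 \<and> (\<forall>k t. pole_quadratic s x1 x2 x3 l k t =
            (t - (l + e k)) * (t - (of_int s + of_nat k - (l + e k))))"
proof -
  define h where "h = (\<lambda>k::nat. (of_int s + of_nat k - 2 * l) / 2)"
  define p where "p = (x1 - l) * (x2 - l) * (x3 - l)"
  define \<rho> where "\<rho> = (\<lambda>k. csqrt (xi_radicand s x1 x2 x3 l k))"
  define r where "r = (\<lambda>k. if norm (\<rho> k - h k) \<le> norm (\<rho> k + h k) then \<rho> k else - \<rho> k)"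
  define e where "e = (\<lambda>k. h k - r k)"
  have rsq: "(r k)\<^sup>2 = xi_radicand s x1 x2 x3 l k" for k by (simp add: r_def \<rho>_def)
  have "norm (e k) \<le> sqrt (norm (p / (l + of_nat k)))" for k
  proof (rule real_le_rsqrt)
    have le: "norm (e k) \<le> norm (h k + r k)"
      by (auto simp: e_def r_def norm_minus_commute add.commute)
    have "(norm (e k))\<^sup>2 \<le> norm (e k) * norm (h k + r k)"
      unfolding power2_eq_square by (rule mult_left_mono[OF le]) simp
    also have "\<dots> = norm ((r k)\<^sup>2 - (h k)\<^sup>2)"
      unfolding norm_mult[symmetric] by (subst norm_minus_commute) (simp add: e_def power2_eq_square algebra_simps)
    also have "(r k)\<^sup>2 - (h k)\<^sup>2 = p / (l + of_nat k)"
      by (simp add: rsq xi_radicand_def h_def p_def)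
    finally show "(norm (e k))\<^sup>2 \<le> norm (p / (l + of_nat k))" .
  qed
  moreover have "(\<lambda>k. sqrt (norm (p / (l + of_nat k)))) \<longlonglongrightarrow> sqrt (norm (0::complex))"
  proof (intro tendsto_intros)
    show "(\<lambda>k. p / (l + of_nat k)) \<longlonglongrightarrow> 0"
      by (intro tendsto_divide_0[OF tendsto_const] tendsto_add_filterlim_at_infinity[OF tendsto_const]
            tendsto_of_nat)
  qed
  ultimately have "e \<longlonglongrightarrow> 0"
    by (intro Lim_null_comparison[of e "\<lambda>k. sqrt (norm (p / (l + of_nat k)))"]) auto
  moreover have "pole_quadratic s x1 x2 x3 l k t =
            (t - (l + e k)) * (t - (of_int s + of_nat k - (l + e k)))" for k t
    unfolding pole_quadratic_def rsq[symmetric] e_def h_def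
    by (simp add: power2_eq_square field_simps)
  ultimately show ?thesis by blast
qed

text \<open>The two roots add up to \<open>s + k\<close>, so running through the window upwards for one root and downwards
  for the other pairs the factor \<open>n + (j - \<tau>)\<close> with \<open>n - (j - \<tau>)\<close>. The parameter \<open>\<tau>\<close> is
  the first root shifted by \<open>1 - s\<close>; the shift makes the range of \<open>j\<close> end at \<open>k\<close>, ready for comparison
  with \<open>k!\<close> and with the product of \<open>N\<^sup>2 - j\<^sup>2\<close>.\<close>

lemma prod_pole_quadratic:
  fixes s n :: int and k :: nat and \<tau> :: complex
  assumes q: "\<And>t. q t = (t - (\<tau> + of_int s - 1)) * (t - (of_int s + of_nat k - (\<tau> + of_int s - 1)))"
  shows "(\<Prod>i = n+1..n + (int k + s - 1). q (of_int i)) =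
           (\<Prod>j = 2-s..int k. (of_int n)\<^sup>2 - (of_int j - \<tau>)\<^sup>2)"
proof -
  have A: "(\<Prod>i = n+1..n + (int k + s - 1). of_int i - (\<tau> + of_int s - 1)) =
      (\<Prod>j = 2-s..int k. of_int n + (of_int j - \<tau>))"
    by (rule prod.reindex_bij_witness[of _ "\<lambda>j. n + j + s - 1" "\<lambda>i. i - n + 1 - s"])
       (auto simp: algebra_simps)
  have B: "(\<Prod>i = n+1..n + (int k + s - 1). of_int i - (of_int s + of_nat k - (\<tau> + of_int s - 1))) =
      (\<Prod>j = 2-s..int k. of_int n - (of_int j - \<tau>))"
    by (rule prod.reindex_bij_witness[of _ "\<lambda>j. n + int k + 1 - j" "\<lambda>i. n + int k + 1 - i"])
       (auto simp: algebra_simps)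
  have C: "(of_int n)\<^sup>2 - (of_int j - \<tau>)\<^sup>2 =
      (of_int n + (of_int j - \<tau>)) * (of_int n - (of_int j - \<tau>))" for j
    by (simp add: power2_eq_square algebra_simps)
  show ?thesis unfolding q prod.distrib A B C ..
qed

lemma norm_one_minus_le_exp: "norm (1 - w) \<le> exp ((norm w)\<^sup>2 / 2 - Re w)" for w :: complex
proof (rule power2_le_imp_le)
  have "(norm (1 - w))\<^sup>2 = 1 + ((norm w)\<^sup>2 - 2 * Re w)"
    unfolding cmod_power2 by (simp add: power2_eq_square algebra_simps)
  also have "\<dots> \<le> exp ((norm w)\<^sup>2 - 2 * Re w)" by (rule exp_ge_add_one_self)
  also have "\<dots> = (exp ((norm w)\<^sup>2 / 2 - Re w))\<^sup>2"
    by (simp add: exp_double[symmetric] field_simps)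
  finally show "(norm (1 - w))\<^sup>2 \<le> (exp ((norm w)\<^sup>2 / 2 - Re w))\<^sup>2" .
qed simp

text \<open>To first order the product is \<open>exp (- Re \<tau> H)\<close>, where \<open>H\<close> is a harmonic sum, about \<open>ln k\<close>.\<close>

lemma prod_one_minus_bound:
  fixes \<tau> :: complex and e B :: real
  assumes J: "1 \<le> J" "J \<le> k" and e: "0 \<le> e" "e \<le> Re \<tau>" and B: "norm \<tau> \<le> B"
  shows "(\<Prod>j = J..k. norm (1 - \<tau> / of_nat j)) \<le>
           exp (B\<^sup>2 / 2 * (\<Sum>j. 1 / (real j)\<^sup>2) + e * harm J) * real k powr (- e)"
proof -
  have summ: "summable (\<lambda>j. 1 / (real j)\<^sup>2)"
    using inverse_power_summable[of 2] by (simp add: inverse_eq_divide power_divide)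
  have "(\<Prod>j = J..k. norm (1 - \<tau> / of_nat j)) \<le>
      (\<Prod>j = J..k. exp (B\<^sup>2 / 2 * (1 / (real j)\<^sup>2) - e * (1 / real j)))"
  proof (rule prod_mono, intro conjI)
    fix j assume "j \<in> {J..k}"
    then have j: "real j > 0" using J by auto
    have 1: "(norm (\<tau> / of_nat j))\<^sup>2 / 2 \<le> B\<^sup>2 / 2 * (1 / (real j)\<^sup>2)"
      using B j by (simp add: norm_divide power_divide divide_simps power_mono)
    have "Re (\<tau> / of_nat j) = Re \<tau> / real j" by (simp add: Re_divide_of_nat)
    then have 2: "e * (1 / real j) \<le> Re (\<tau> / of_nat j)" using e j by (simp add: divide_simps)
    show "norm (1 - \<tau> / of_nat j) \<le> exp (B\<^sup>2 / 2 * (1 / (real j)\<^sup>2) - e * (1 / real j))"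
      by (rule order_trans[OF norm_one_minus_le_exp]) (use 1 2 in simp)
  qed simp
  also have "\<dots> = exp (B\<^sup>2 / 2 * (\<Sum>j = J..k. 1 / (real j)\<^sup>2) - e * (\<Sum>j = J..k. 1 / real j))"
    by (simp add: exp_sum[symmetric] sum_subtractf sum_distrib_left)
  also have "\<dots> \<le> exp (B\<^sup>2 / 2 * (\<Sum>j. 1 / (real j)\<^sup>2) - e * (ln (real k) - harm J))"
  proof -
    have "(\<Sum>j = J..k. 1 / (real j)\<^sup>2) \<le> (\<Sum>j. 1 / (real j)\<^sup>2)"
      by (rule sum_le_suminf[OF summ]) auto
    then have 1: "B\<^sup>2 / 2 * (\<Sum>j = J..k. 1 / (real j)\<^sup>2) \<le> B\<^sup>2 / 2 * (\<Sum>j. 1 / (real j)\<^sup>2)"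
      by (intro mult_left_mono) auto
    have "ln (real k) \<le> ln (real k + 1)" using J by simp
    also have "\<dots> \<le> harm k" by (rule ln_le_harm)
    also have "(harm k :: real) = (\<Sum>j = 1..<J. 1 / real j) + (\<Sum>j = J..k. 1 / real j)"
    proof -
      have "{1..k} = {1..<J} \<union> {J..k}" using J by auto
      moreover have "(\<Sum>j\<in>{1..<J} \<union> {J..k}. 1 / real j) =
          (\<Sum>j = 1..<J. 1 / real j) + (\<Sum>j = J..k. 1 / real j)"
        by (rule sum.union_disjoint) auto
      ultimately show ?thesis by (simp add: harm_def inverse_eq_divide)
    qed
    also have "(\<Sum>j = 1..<J. 1 / real j) \<le> harm J"
      unfolding harm_def inverse_eq_divide by (rule sum_mono2) auto
    finally have "ln (real k) - harm J \<le> (\<Sum>j = J..k. 1 / real j)" by simp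
    then have 2: "e * (ln (real k) - harm J) \<le> e * (\<Sum>j = J..k. 1 / real j)"
      using e by (intro mult_left_mono) auto
    show ?thesis using 1 2 by simp
  qed
  also have "\<dots> = exp (B\<^sup>2 / 2 * (\<Sum>j. 1 / (real j)\<^sup>2) + e * harm J) * real k powr (- e)"
    using J by (simp add: powr_def exp_add[symmetric] algebra_simps)
  finally show ?thesis .
qed

text \<open>This gives the decay of the terms of the series. The first few factors, or the first few missing
  ones if \<open>s \<le> 0\<close>, only affect the constant.\<close>

lemma prod_shifted_upper_bound:
  fixes s :: int and e B :: real
  assumes "0 \<le> e" "0 \<le> B"
  shows "\<exists>C. \<forall>k \<tau>. 1 \<le> k \<longrightarrow> 2 - s \<le> int k \<longrightarrow> e \<le> Re \<tau> \<longrightarrow> norm \<tau> \<le> B \<longrightarrow>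
           norm (\<Prod>j = 2-s..int k. of_int j - \<tau>) \<le> C * (fact k * real k powr (- e))"
proof (intro exI allI impI)
  fix k :: nat and \<tau> :: complex
  assume k: "1 \<le> k" "2 - s \<le> int k" and \<tau>: "e \<le> Re \<tau>" "norm \<tau> \<le> B"
  \<comment> \<open>the first index that is both positive and in the range of the product\<close>
  define J where "J = nat (max 1 (2 - s))"
  have J: "1 \<le> J" "J \<le> k" using k by (auto simp: J_def)
  define C1 where "C1 = (\<Prod>j = 2-s..int J - 1. \<bar>real_of_int j\<bar> + B)"
  define C2 where "C2 = exp (B\<^sup>2 / 2 * (\<Sum>j. 1 / (real j)\<^sup>2) + e * harm J)"
  have C1: "C1 \<ge> 0" unfolding C1_def using assms by (intro prod_nonneg) auto
  have "(\<Prod>j = 2-s..int k. of_int j - \<tau>) =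
      (\<Prod>j = 2-s..int J - 1. of_int j - \<tau>) * (\<Prod>j = int J - 1 + 1..int k. of_int j - \<tau>)"
    by (rule prod_int_interval_split) (use J in \<open>auto simp: J_def\<close>)
  also have "(\<Prod>j = int J - 1 + 1..int k. of_int j - \<tau>) = (\<Prod>j = J..k. of_nat j - \<tau>)"
    by (rule prod.reindex_bij_witness[of _ int nat]) auto
  finally have "norm (\<Prod>j = 2-s..int k. of_int j - \<tau>) =
      (\<Prod>j = 2-s..int J - 1. norm (of_int j - \<tau>)) * (\<Prod>j = J..k. norm (of_nat j - \<tau>))"
    by (simp add: norm_mult prod_norm)
  also have "\<dots> \<le> C1 * (fact k * (C2 * real k powr (- e)))"
  proof (rule mult_mono[OF _ _ C1])
    have "norm (of_int j - \<tau>) \<le> \<bar>real_of_int j\<bar> + B" for j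
      using norm_triangle_ineq4[of "of_int j" \<tau>] \<tau> by simp
    then show "(\<Prod>j = 2-s..int J - 1. norm (of_int j - \<tau>)) \<le> C1"
      unfolding C1_def by (intro prod_mono) auto
    have "(\<Prod>j = J..k. norm (of_nat j - \<tau>)) = (\<Prod>j = J..k. real j * norm (1 - \<tau> / of_nat j))"
    proof (intro prod.cong refl)
      fix j assume "j \<in> {J..k}"
      then have "of_nat j - \<tau> = of_nat j * (1 - \<tau> / of_nat j)" using J by (simp add: field_simps)
      then have "norm (of_nat j - \<tau>) = norm (of_nat j * (1 - \<tau> / of_nat j))" by simp
      then show "norm (of_nat j - \<tau>) = real j * norm (1 - \<tau> / of_nat j)"
        by (simp only: norm_mult norm_of_nat)
    qed
    also have "\<dots> = (\<Prod>j = J..k. real j) * (\<Prod>j = J..k. norm (1 - \<tau> / of_nat j))"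
      by (rule prod.distrib)
    also have "\<dots> \<le> fact k * (C2 * real k powr (- e))"
    proof (intro mult_mono)
      have "(\<Prod>j = J..k. real j) \<le> (\<Prod>j = 1..k. real j)"
        by (rule prod_mono2) (use J in auto)
      then show "(\<Prod>j = J..k. real j) \<le> fact k" by (simp add: fact_prod)
      show "(\<Prod>j = J..k. norm (1 - \<tau> / of_nat j)) \<le> C2 * real k powr (- e)"
        unfolding C2_def by (rule prod_one_minus_bound) (use J assms \<tau> in auto)
    qed (auto intro: prod_nonneg)
    finally show "(\<Prod>j = J..k. norm (of_nat j - \<tau>)) \<le> fact k * (C2 * real k powr (- e))" .
  qed (auto intro: prod_nonneg)
  finally show "norm (\<Prod>j = 2-s..int k. of_int j - \<tau>) \<le>
     ((\<Prod>j = 2-s..int (nat (max 1 (2 - s))) - 1. \<bar>real_of_int j\<bar> + B) *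
     exp (B\<^sup>2 / 2 * (\<Sum>j. 1 / (real j)\<^sup>2) + e * harm (nat (max 1 (2 - s))))) * (fact k * real k powr (- e))"
    unfolding C1_def C2_def J_def by (simp add: mult_ac)
qed

text \<open>The factor by which truncation at \<open>N\<close> changes the \<open>k\<close>-th term is bounded uniformly in
  \<open>k < N\<close>. Factor \<open>N\<^sup>2 - (j - \<tau>)\<^sup>2 = (N - j + \<tau>) (N + j - \<tau>)\<close>. Since \<open>Re \<tau> \<ge> 0\<close>, the first factor
  is at least \<open>N - j\<close> in modulus, even for \<open>j\<close> close to \<open>N\<close>; the second loses at most the factor
  \<open>1 - B / N\<close>, and fewer than \<open>N\<close> such factors cost only a constant.\<close>

lemma prod_shifted_lower_bound:
  fixes s :: int and B :: real
  assumes B: "0 \<le> B"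
  shows "\<exists>C N0. \<forall>N k \<tau>. N0 \<le> N \<longrightarrow> k < N \<longrightarrow> 1 \<le> k \<longrightarrow> 2 - s \<le> int k \<longrightarrow>
           0 \<le> Re \<tau> \<longrightarrow> norm \<tau> \<le> B \<longrightarrow>
           real N powi (2 * (s - 1)) * (\<Prod>j = 1..k. (real N)\<^sup>2 - (real j)\<^sup>2) \<le>
             C * norm (\<Prod>j = 2-s..int k. (of_nat N)\<^sup>2 - (of_int j - \<tau>)\<^sup>2)"
proof -
  define c where "c = exp (- B) / 2"
  have c: "c > 0" by (simp add: c_def)
  have "(\<lambda>N. (1 + - B / real N) ^ N) \<longlonglongrightarrow> exp (- B)" by (rule tendsto_exp_limit_sequentially)
  then have "eventually (\<lambda>N. (1 + - B / real N) ^ N > c) sequentially"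
    by (rule order_tendstoD) (simp add: c_def)
  then obtain N1 where N1: "\<And>N. N \<ge> N1 \<Longrightarrow> (1 + - B / real N) ^ N > c"
    by (auto simp: eventually_sequentially)
  define N0 where "N0 = max N1 (nat \<lceil>2 * (\<bar>real_of_int s\<bar> + B) + 1\<rceil>)"
  \<comment> \<open>the \<open>s - 1\<close> factors with index at most \<open>0\<close>, present if \<open>s > 1\<close>, each lose at most a factor \<open>2\<close>\<close>
  define C where "C = 2 ^ nat (s - 1) / c"
  have "real N powi (2 * (s - 1)) * (\<Prod>j = 1..k. (real N)\<^sup>2 - (real j)\<^sup>2) \<le>
             C * norm (\<Prod>j = 2-s..int k. (of_nat N)\<^sup>2 - (of_int j - \<tau>)\<^sup>2)"
    if N: "N0 \<le> N" and k: "k < N" "1 \<le> k" "2 - s \<le> int k" and \<tau>: "0 \<le> Re \<tau>" "norm \<tau> \<le> B"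
    for N k and \<tau> :: complex
  proof -
    have NB: "real N \<ge> 2 * (\<bar>real_of_int s\<bar> + B) + 1" and N1': "N \<ge> N1"
      using N unfolding N0_def by linarith+
    have Npos: "real N > 0" by (rule less_le_trans[OF _ NB]) (use B in \<open>simp add: add_nonneg_pos\<close>)
    \<comment> \<open>from \<open>J\<close> on, every index is positive and occurs in both products\<close>
    define J where "J = nat (max 1 (2 - s))"
    have J: "1 \<le> J" "J \<le> k" using k by (auto simp: J_def)
    define F where "F = (\<lambda>j::int. norm ((of_nat N)\<^sup>2 - (of_int j - \<tau>)\<^sup>2))"
    define G where "G = (\<lambda>j::nat. (real N)\<^sup>2 - (real j)\<^sup>2)"
    have G: "G j \<ge> 0" if "j \<le> k" for j
      using that k by (auto simp: G_def intro!: power_mono)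
    have "(\<Prod>j = 2-s..int k. F j) =
        (\<Prod>j = 2-s..int J - 1. F j) * (\<Prod>j = int J - 1 + 1..int k. F j)"
      by (rule prod_int_interval_split) (use J in \<open>auto simp: J_def\<close>)
    also have "(\<Prod>j = int J - 1 + 1..int k. F j) = (\<Prod>j = J..k. F (int j))"
      by (rule prod.reindex_bij_witness[of _ int nat]) auto
    finally have Fsplit: "(\<Prod>j = 2-s..int k. F j) =
        (\<Prod>j = 2-s..int J - 1. F j) * (\<Prod>j = J..k. F (int j))" .
    have "{1..k} = {1..<J} \<union> {J..k}" using J by auto
    moreover have "(\<Prod>j\<in>{1..<J} \<union> {J..k}. G j) = (\<Prod>j = 1..<J. G j) * (\<Prod>j = J..k. G j)"
      by (rule prod.union_disjoint) auto
    ultimately have Gsplit: "(\<Prod>j = 1..k. G j) = (\<Prod>j = 1..<J. G j) * (\<Prod>j = J..k. G j)"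
      by simp
    have main: "c * (\<Prod>j = J..k. G j) \<le> (\<Prod>j = J..k. F (int j))"
    proof -
      define b where "b = 1 - B / real N"
      have b: "0 \<le> b" "b \<le> 1" using NB B Npos by (auto simp: b_def divide_simps)
      have "c \<le> b ^ N" using N1[OF N1'] by (simp add: b_def)
      also have "\<dots> \<le> b ^ card {J..k}" using b k by (intro power_decreasing) auto
      finally have "c * (\<Prod>j = J..k. G j) \<le> b ^ card {J..k} * (\<Prod>j = J..k. G j)"
        by (intro mult_right_mono prod_nonneg G) auto
      also have "\<dots> = (\<Prod>j = J..k. b * G j)" by (simp add: prod.distrib)
      also have "\<dots> \<le> (\<Prod>j = J..k. F (int j))"
      proof (rule prod_mono, intro conjI)
        fix j assume "j \<in> {J..k}"
        then have j: "j \<le> k" "real j < real N" using k by auto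
        show "0 \<le> b * G j" using b G[OF j(1)] by simp
        have 1: "real N - real j \<le> norm (of_nat N - of_nat j + \<tau>)"
          using complex_Re_le_cmod[of "of_nat N - of_nat j + \<tau>"] \<tau> by simp
        have "real N + real j = norm (of_nat N + of_nat j :: complex)"
          by (metis norm_of_nat of_nat_add)
        then have 2: "real N + real j - B \<le> norm (of_nat N + of_nat j - \<tau>)"
          using norm_triangle_ineq2[of "of_nat N + of_nat j" \<tau>] \<tau> by simp
        have "b * (real N + real j) = real N + real j - B - B * real j / real N"
          using Npos by (simp add: b_def field_simps)
        also have "\<dots> \<le> real N + real j - B" using B by simp
        finally have 3: "b * (real N + real j) \<le> real N + real j - B" .
        have "b * G j = (real N - real j) * (b * (real N + real j))"
          by (simp add: G_def power2_eq_square algebra_simps)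
        also have "\<dots> \<le> norm (of_nat N - of_nat j + \<tau>) * norm (of_nat N + of_nat j - \<tau>)"
          by (intro mult_mono) (use 1 2 3 j b in auto)
        also have "\<dots> = F (int j)"
          unfolding F_def norm_mult[symmetric] by (simp add: power2_eq_square algebra_simps)
        finally show "b * G j \<le> F (int j)" .
      qed
      finally show ?thesis .
    qed
    have rest: "real N powi (2 * (s - 1)) * (\<Prod>j = 1..<J. G j) \<le>
        2 ^ nat (s - 1) * (\<Prod>j = 2-s..int J - 1. F j)"
    proof (cases "s \<ge> 1")
      case True
      have J1: "J = 1" using True by (simp add: J_def)
      have F: "(real N)\<^sup>2 / 2 \<le> F j" if "j \<in> {2-s..0}" for j
      proof -
        have "norm (of_int j - \<tau>) \<le> \<bar>real_of_int j\<bar> + B"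
          using norm_triangle_ineq4[of "of_int j" \<tau>] \<tau> by simp
        also have "\<dots> \<le> \<bar>real_of_int s\<bar> + B" using that by auto
        also have "\<dots> \<le> real N / 2" using NB by simp
        finally have "(norm (of_int j - \<tau>))\<^sup>2 \<le> (real N / 2)\<^sup>2" by (intro power_mono) auto
        then have "norm ((of_int j - \<tau>)\<^sup>2) \<le> (real N)\<^sup>2 / 4"
          by (simp add: norm_power power_divide)
        also have "\<dots> \<le> (real N)\<^sup>2 / 2" by simp
        finally have "norm ((of_int j - \<tau>)\<^sup>2) \<le> (real N)\<^sup>2 / 2" .
        moreover have "norm ((of_nat N)\<^sup>2 :: complex) = (real N)\<^sup>2" by (simp add: norm_power)
        ultimately show ?thesis
          using norm_triangle_ineq2[of "(of_nat N)\<^sup>2" "(of_int j - \<tau>)\<^sup>2"] unfolding F_def by linarith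
      qed
      have card: "card {2-s..0} = nat (s - 1)" by simp
      have "real N powi (2 * (s - 1)) = ((real N)\<^sup>2) ^ nat (s - 1)"
        unfolding power_int_mult using True by (simp add: power_int_def)
      also have "\<dots> = 2 ^ nat (s - 1) * (\<Prod>j = 2-s..0. (real N)\<^sup>2 / 2)"
        by (simp only: prod_constant card power_divide) simp
      also have "\<dots> \<le> 2 ^ nat (s - 1) * (\<Prod>j = 2-s..0. F j)"
        by (intro mult_left_mono prod_mono) (use F in auto)
      finally show ?thesis by (simp add: J1)
    next
      case False
      have Js: "int J = 2 - s" using False by (simp add: J_def)
      have "(\<Prod>j = 1..<J. G j) \<le> (\<Prod>j = 1..<J. (real N)\<^sup>2)"
        by (intro prod_mono) (use G J in \<open>auto simp: G_def\<close>)
      also have "\<dots> = (real N)\<^sup>2 ^ nat (1 - s)"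
      proof -
        have "J - 1 = nat (1 - s)" using Js by linarith
        then show ?thesis by simp
      qed
      also have "\<dots> = inverse (real N powi (2 * (s - 1)))"
        unfolding power_int_mult using False by (simp add: power_int_def power_inverse)
      finally have "real N powi (2 * (s - 1)) * (\<Prod>j = 1..<J. G j) \<le>
          real N powi (2 * (s - 1)) * inverse (real N powi (2 * (s - 1)))"
        by (intro mult_left_mono) auto
      also have "\<dots> = 1" using Npos by simp
      finally show ?thesis using False Js by simp
    qed
    have "real N powi (2 * (s - 1)) * (\<Prod>j = 1..k. G j) =
        (real N powi (2 * (s - 1)) * (\<Prod>j = 1..<J. G j)) * (\<Prod>j = J..k. G j)"
      unfolding Gsplit by (simp only: mult.assoc)
    also have "\<dots> \<le> (2 ^ nat (s - 1) * (\<Prod>j = 2-s..int J - 1. F j)) * (\<Prod>j = J..k. G j)"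
      by (intro mult_right_mono rest prod_nonneg G) auto
    also have "\<dots> \<le> (2 ^ nat (s - 1) * (\<Prod>j = 2-s..int J - 1. F j)) * ((\<Prod>j = J..k. F (int j)) / c)"
    proof (rule mult_left_mono)
      show "(\<Prod>j = J..k. G j) \<le> (\<Prod>j = J..k. F (int j)) / c"
        using main c by (simp add: field_simps)
    qed (auto simp: F_def intro!: mult_nonneg_nonneg prod_nonneg)
    also have "\<dots> = C * (\<Prod>j = 2-s..int k. F j)"
      by (simp add: C_def Fsplit)
    finally show ?thesis
      unfolding G_def F_def by (simp only: prod_norm)
  qed
  then show ?thesis by blast
qed

lemma shift_prod_translate: "shift_prod f n m = shift_prod (\<lambda>i. f (n + i)) 0 m"
proof -
  have "(\<Prod>i = n+1..n+m. f i) = (\<Prod>i = 0+1..0+m. f (n + i))"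
    by (rule prod.reindex_bij_witness[of _ "\<lambda>i. n + i" "\<lambda>i. i - n"]) auto
  moreover have "(\<Prod>i = n+m+1..n. f i) = (\<Prod>i = 0+m+1..0. f (n + i))"
    by (rule prod.reindex_bij_witness[of _ "\<lambda>i. n + i" "\<lambda>i. i - n"]) auto
  ultimately show ?thesis by (simp add: shift_prod_def)
qed

lemma shift_prod_divide_const:
  assumes "c \<noteq> 0"
  shows "shift_prod (\<lambda>i. f i / c) n m = shift_prod f n m / c powi m"
  using assms by (auto simp: shift_prod_def prod_dividef power_int_def power_inverse field_simps)

lemma pole_quadratic_shift_LIMSEQ:
  "(\<lambda>N. pole_quadratic s x1 x2 x3 l k (of_int (int N + i)) / (of_nat N)\<^sup>2) \<longlonglongrightarrow> 1"
proof -
  define c where "c = of_int i - (of_int s + of_nat k) / (2::complex)"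
  define R where "R = xi_radicand s x1 x2 x3 l k"
  have "(\<lambda>N. (1 + c * (1 / of_nat N))\<^sup>2 - R * (1 / of_nat N)\<^sup>2) \<longlonglongrightarrow> (1 + c * 0)\<^sup>2 - R * 0\<^sup>2"
    by (intro tendsto_intros lim_1_over_n)
  moreover have "eventually (\<lambda>N. (1 + c * (1 / of_nat N))\<^sup>2 - R * (1 / of_nat N)\<^sup>2 =
      pole_quadratic s x1 x2 x3 l k (of_int (int N + i)) / (of_nat N)\<^sup>2) sequentially"
    using eventually_gt_at_top[of 0]
    by eventually_elim
       (simp add: pole_quadratic_def R_def c_def divide_simps power2_eq_square, simp add: algebra_simps)
  ultimately show ?thesis by (simp add: tendsto_cong)
qed

text \<open>For fixed \<open>k\<close> all factors behave like powers of \<open>N\<close>, and the exponents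
  \<open>2 (s - 1) + 2 k\<close> and \<open>2 m\<close> agree.\<close>

lemma truncation_factor_LIMSEQ:
  fixes s :: int and k :: nat and x1 x2 x3 l :: complex
  defines "m \<equiv> int k + s - 1"
  defines "D \<equiv> \<lambda>N::nat. shift_prod (\<lambda>i. pole_quadratic s x1 x2 x3 l k (of_int i)) (int N) m"
  shows "(\<lambda>N. of_nat N powi (2 * (s - 1)) * (\<Prod>j = 1..k. (of_nat N)\<^sup>2 - (of_nat j)\<^sup>2) / D N) \<longlonglongrightarrow> 1"
    and "eventually (\<lambda>N. D N \<noteq> 0) sequentially"
proof -
  define h where "h = (\<lambda>N::nat. \<lambda>i. pole_quadratic s x1 x2 x3 l k (of_int (int N + i)) / (of_nat N)\<^sup>2)"
  have "(\<lambda>N. shift_prod (h N) 0 m) \<longlonglongrightarrow> shift_prod (\<lambda>_. 1) 0 m"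
    by (rule tendsto_shift_prod) (use pole_quadratic_shift_LIMSEQ in \<open>simp_all add: h_def\<close>)
  moreover have "shift_prod (\<lambda>_. 1) 0 m = (1 :: complex)" by (simp add: shift_prod_def)
  ultimately have h_lim: "(\<lambda>N. shift_prod (h N) 0 m) \<longlonglongrightarrow> 1" by simp
  have h_eq: "shift_prod (h N) 0 m = D N / ((of_nat N)\<^sup>2) powi m" if "N > 0" for N
    unfolding h_def D_def using that
    by (subst shift_prod_divide_const) (auto simp: shift_prod_translate[of _ "int N"])
  have "eventually (\<lambda>N. shift_prod (h N) 0 m \<noteq> 0) sequentially"
    by (rule tendsto_imp_eventually_ne[OF h_lim]) simp
  with eventually_gt_at_top[of 0] show "eventually (\<lambda>N. D N \<noteq> 0) sequentially"
    by eventually_elim (auto simp: h_eq)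
  have "(\<lambda>N. (\<Prod>j = 1..k. 1 - (of_nat j)\<^sup>2 * (1 / of_nat N)\<^sup>2) / shift_prod (h N) 0 m)
      \<longlonglongrightarrow> (\<Prod>j = 1..k. 1 - (of_nat j)\<^sup>2 * 0\<^sup>2) / (1 :: complex)"
    by (intro tendsto_intros lim_1_over_n h_lim) auto
  moreover have "eventually (\<lambda>N. (\<Prod>j = 1..k. 1 - (of_nat j)\<^sup>2 * (1 / of_nat N)\<^sup>2) / shift_prod (h N) 0 m =
      of_nat N powi (2 * (s - 1)) * (\<Prod>j = 1..k. (of_nat N)\<^sup>2 - (of_nat j)\<^sup>2) / D N) sequentially"
    using eventually_gt_at_top[of 0]
  proof eventually_elim
    case (elim N)
    then have N: "(of_nat N :: complex) \<noteq> 0" by simp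
    have "(\<Prod>j = 1..k. 1 - (of_nat j)\<^sup>2 * (1 / of_nat N)\<^sup>2) =
        (\<Prod>j = 1..k. ((of_nat N)\<^sup>2 - (of_nat j)\<^sup>2) / (of_nat N :: complex)\<^sup>2)"
      by (intro prod.cong refl) (use N in \<open>simp add: divide_simps\<close>)
    then have P: "(\<Prod>j = 1..k. 1 - (of_nat j)\<^sup>2 * (1 / of_nat N)\<^sup>2) =
        (\<Prod>j = 1..k. (of_nat N)\<^sup>2 - (of_nat j)\<^sup>2) / ((of_nat N :: complex)\<^sup>2) ^ k"
      by (simp add: prod_dividef)
    have "((of_nat N :: complex)\<^sup>2) powi m = ((of_nat N)\<^sup>2) powi (s - 1) * ((of_nat N)\<^sup>2) ^ k"
      using N power_int_add[of "(of_nat N :: complex)\<^sup>2" "s - 1" "int k"]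
      by (simp add: m_def algebra_simps)
    also have "((of_nat N :: complex)\<^sup>2) powi (s - 1) = of_nat N powi (2 * (s - 1))"
      using power_int_mult[of "of_nat N :: complex" 2 "s - 1"] by simp
    finally have M: "((of_nat N :: complex)\<^sup>2) powi m =
        of_nat N powi (2 * (s - 1)) * ((of_nat N)\<^sup>2) ^ k" .
    show ?case unfolding P h_eq[OF elim] M using N by (simp add: field_simps)
  qed
  ultimately show "(\<lambda>N. of_nat N powi (2 * (s - 1)) * (\<Prod>j = 1..k. (of_nat N)\<^sup>2 - (of_nat j)\<^sup>2) / D N) \<longlonglongrightarrow> 1"
    by (simp add: tendsto_cong)
qed

section \<open>Passage to the limit\<close>

lemma powi_nat_eq_exp_ln:
  assumes "N > 0"
  shows "(of_nat N :: complex) powi m = exp (of_int m * of_real (ln (of_nat N)))"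
proof -
  have "exp (of_real (ln (of_nat N))) = (of_nat N :: complex)"
    using assms by (simp add: exp_of_real)
  then show ?thesis by (metis exp_power_int mult.commute)
qed

text \<open>The powers of \<open>N\<close> for the three points multiply to an integer power because \<open>x1 + x2 + x3 = s\<close>.\<close>

lemma Gamma_product_LIMSEQ:
  fixes x1 x2 x3 :: complex
  assumes sum: "x1 + x2 + x3 = of_int s"
    and x: "x1 \<notin> \<int>\<^sub>\<le>\<^sub>0" "x2 \<notin> \<int>\<^sub>\<le>\<^sub>0" "x3 \<notin> \<int>\<^sub>\<le>\<^sub>0"
  shows "(\<lambda>N. of_nat N powi (2 * s - 3) *
           (\<Prod>j<N. cubic x1 x2 x3 (of_nat (Suc j)) / (- cubic x1 x2 x3 (- of_nat j))))
         \<longlonglongrightarrow> Gamma x1 * Gamma x2 * Gamma x3 * (rGamma (1 - x1) * rGamma (1 - x2) * rGamma (1 - x3))"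
proof -
  let ?g = "\<lambda>z N. exp ((2 * z - 1) * of_real (ln (of_nat N))) * (pochhammer (1 - z) N / pochhammer z N)"
  have "(\<lambda>N. ?g x1 N * ?g x2 N * ?g x3 N) \<longlonglongrightarrow>
     (Gamma x1 * rGamma (1 - x1)) * (Gamma x2 * rGamma (1 - x2)) * (Gamma x3 * rGamma (1 - x3))"
    by (intro tendsto_mult pochhammer_ratio_LIMSEQ x)
  moreover have "eventually (\<lambda>N. ?g x1 N * ?g x2 N * ?g x3 N = of_nat N powi (2 * s - 3) *
       (\<Prod>j<N. cubic x1 x2 x3 (of_nat (Suc j)) / (- cubic x1 x2 x3 (- of_nat j)))) sequentially"
    using eventually_gt_at_top[of 0]
  proof eventually_elim
    case (elim N)
    have "of_int (2 * s - 3) = (2 * x1 - 1) + (2 * x2 - 1) + (2 * x3 - (1::complex))"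
      using sum[symmetric] by simp
    then have e: "(of_nat N :: complex) powi (2 * s - 3) = exp ((2 * x1 - 1) * of_real (ln (of_nat N))) *
        exp ((2 * x2 - 1) * of_real (ln (of_nat N))) * exp ((2 * x3 - 1) * of_real (ln (of_nat N)))"
      unfolding powi_nat_eq_exp_ln[OF elim] by (simp only: exp_add distrib_right)
    have p: "pochhammer (1 - z) N / pochhammer z N = (\<Prod>j<N. (of_nat (Suc j) - z) / (z + of_nat j))"
      for z :: complex
      by (simp add: pochhammer_prod prod_dividef atLeast0LessThan algebra_simps)
    have "(\<Prod>j<N. cubic x1 x2 x3 (of_nat (Suc j)) / (- cubic x1 x2 x3 (- of_nat j))) =
      (\<Prod>j<N. (of_nat (Suc j) - x1) / (x1 + of_nat j) * ((of_nat (Suc j) - x2) / (x2 + of_nat j)) *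
         ((of_nat (Suc j) - x3) / (x3 + of_nat j)))"
    proof (intro prod.cong refl)
      fix j
      have "- cubic x1 x2 x3 (- of_nat j) = (x1 + of_nat j) * (x2 + of_nat j) * (x3 + of_nat j)"
        by (simp add: cubic_def algebra_simps)
      then show "cubic x1 x2 x3 (of_nat (Suc j)) / (- cubic x1 x2 x3 (- of_nat j)) =
         (of_nat (Suc j) - x1) / (x1 + of_nat j) * ((of_nat (Suc j) - x2) / (x2 + of_nat j)) *
         ((of_nat (Suc j) - x3) / (x3 + of_nat j))"
        by (simp only: cubic_def times_divide_times_eq)
    qed
    then show ?case unfolding e by (simp only: p prod.distrib mult_ac)
  qed
  ultimately show ?thesis by (simp add: tendsto_cong mult_ac)
qed

text \<open>The product is a ratio of Pochhammer symbols of order \<open>N\<close> to the power \<open>1 - 2 l\<close>, so the total exponent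
  is \<open>- 2 (l + 1 - s)\<close>.\<close>

lemma value_at_infinity_LIMSEQ:
  fixes l :: complex
  assumes l: "l \<notin> \<int>\<^sub>\<le>\<^sub>0" and Re: "Re (l + 1 - of_int s) > 0"
  shows "(\<lambda>N. of_nat N powi (2 * s - 3) * (\<Prod>j<N. (of_nat (Suc j) - l) / (l + of_nat j))) \<longlonglongrightarrow> 0"
proof -
  define \<sigma> where "\<sigma> = l + 1 - of_int s"
  have "(\<lambda>N. real N powr (- (2 * Re \<sigma>))) \<longlonglongrightarrow> 0"
    by (rule tendsto_neg_powr[OF _ filterlim_real_sequentially]) (use Re in \<open>simp add: \<sigma>_def\<close>)
  moreover have "eventually (\<lambda>N. norm (exp (- (2 * \<sigma>) * of_real (ln (of_nat N)))) =
      real N powr (- (2 * Re \<sigma>))) sequentially"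
    using eventually_gt_at_top[of 0]
    by eventually_elim (simp add: norm_exp_eq_Re powr_def)
  ultimately have "(\<lambda>N. norm (exp (- (2 * \<sigma>) * of_real (ln (of_nat N))))) \<longlonglongrightarrow> 0"
    by (simp add: tendsto_cong)
  then have "(\<lambda>N. exp (- (2 * \<sigma>) * of_real (ln (of_nat N)))) \<longlonglongrightarrow> 0"
    by (rule tendsto_norm_zero_cancel)
  then have "(\<lambda>N. exp (- (2 * \<sigma>) * of_real (ln (of_nat N))) *
      (exp ((2 * l - 1) * of_real (ln (of_nat N))) * (pochhammer (1 - l) N / pochhammer l N)))
      \<longlonglongrightarrow> 0 * (Gamma l * rGamma (1 - l))"
    by (intro tendsto_mult pochhammer_ratio_LIMSEQ l)
  moreover have "eventually (\<lambda>N. exp (- (2 * \<sigma>) * of_real (ln (of_nat N))) *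
      (exp ((2 * l - 1) * of_real (ln (of_nat N))) * (pochhammer (1 - l) N / pochhammer l N)) =
      of_nat N powi (2 * s - 3) * (\<Prod>j<N. (of_nat (Suc j) - l) / (l + of_nat j))) sequentially"
    using eventually_gt_at_top[of 0]
  proof eventually_elim
    case (elim N)
    have "of_int (2 * s - 3) = - (2 * \<sigma>) + (2 * l - 1)" by (simp add: \<sigma>_def algebra_simps)
    then have e: "(of_nat N :: complex) powi (2 * s - 3) =
        exp (- (2 * \<sigma>) * of_real (ln (of_nat N))) * exp ((2 * l - 1) * of_real (ln (of_nat N)))"
      unfolding powi_nat_eq_exp_ln[OF elim] by (simp only: exp_add distrib_right)
    have p: "pochhammer (1 - l) N / pochhammer l N = (\<Prod>j<N. (of_nat (Suc j) - l) / (l + of_nat j))"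
      by (simp add: pochhammer_prod prod_dividef atLeast0LessThan algebra_simps)
    show ?case unfolding e p by (simp only: mult.assoc)
  qed
  ultimately show ?thesis by (simp add: tendsto_cong)
qed

lemma reciprocal_term_bound:
  "eventually (\<lambda>k. norm (reciprocal_term x1 x2 x3 l k) \<le> 8 / real k) sequentially"
proof -
  have *: "eventually (\<lambda>k. norm (1 / (z + of_nat k)) \<le> 2 / real k) sequentially" for z :: complex
    using eventually_gt_at_top[of "nat \<lceil>2 * norm z\<rceil>"]
  proof eventually_elim
    case (elim k)
    then have k: "real k > 2 * norm z" "real k > 0" by linarith+
    have "real k - norm z \<le> norm (z + of_nat k)"
      using norm_triangle_ineq2[of "of_nat k" "- z"] by (simp add: add.commute)
    then have "real k / 2 \<le> norm (z + of_nat k)" using k by linarith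
    then have "1 / norm (z + of_nat k) \<le> 1 / (real k / 2)" using k by (intro frac_le) auto
    then show ?case by (simp add: norm_divide)
  qed
  from *[of x1] *[of x2] *[of x3] *[of l] show ?thesis
  proof eventually_elim
    case (elim k)
    have "norm (reciprocal_term x1 x2 x3 l k) \<le> norm (1 / (x1 + of_nat k)) +
       norm (1 / (x2 + of_nat k)) + norm (1 / (x3 + of_nat k)) + norm (1 / (l + of_nat k))"
      unfolding reciprocal_term_def
      by (intro order_trans[OF norm_triangle_ineq4] add_mono order_trans[OF norm_triangle_ineq] order_refl)
    then show ?case using elim by linarith
  qed
qed

theorem mainTheorem1:
  fixes s :: int and x1 x2 x3 l :: complex and r :: "nat \<Rightarrow> complex"
  assumes "x1 + x2 + x3 = of_int s"
    and "Re (l + 1 - of_int s) > 0"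
    and "x1 \<notin> \<int>\<^sub>\<le>\<^sub>0" and "x2 \<notin> \<int>\<^sub>\<le>\<^sub>0" and "x3 \<notin> \<int>\<^sub>\<le>\<^sub>0" and "l \<notin> \<int>\<^sub>\<le>\<^sub>0"
    and "\<And>k. (r k)\<^sup>2 = xi_radicand s x1 x2 x3 l k"
    and "\<And>k. int_pochhammer_well_defined (xi s k (r k)) (int k + s - 1)"
  shows "(\<lambda>k. (-1) powi (s + 1) * (int_pochhammer (xi s k (r k)) (int k + s - 1))\<^sup>2 / (fact k)\<^sup>2
            * (1 / (x1 + of_nat k) + 1 / (x2 + of_nat k) + 1 / (x3 + of_nat k) - 1 / (l + of_nat k)))
         sums (Gamma x1 * Gamma x2 * Gamma x3 * (rGamma (1 - x1) * rGamma (1 - x2) * rGamma (1 - x3)))"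
proof -
  define m where "m = (\<lambda>k::nat. int k + s - 1)"
  define f where "f = (\<lambda>k (i::int). pole_quadratic s x1 x2 x3 l k (of_int i))"
  define t where "t = (\<lambda>k. (-1) powi (s + 1) * (int_pochhammer (xi s k (r k)) (m k))\<^sup>2 / (fact k)\<^sup>2
            * reciprocal_term x1 x2 x3 l k)"
  \<comment> \<open>the factor by which truncation at \<open>N\<close> changes the term \<open>t k\<close>\<close>
  define U where "U = (\<lambda>N k. of_nat N powi (2 * (s - 1)) *
      (\<Prod>j = 1..k. (of_nat N)\<^sup>2 - (of_nat j)\<^sup>2) / shift_prod (f k) (int N) (m k))"
  define a where "a = (\<lambda>k N. if k < N then t k * U N k else 0)"
  define \<sigma> where "\<sigma> = Re (l + 1 - of_int s)"
  have \<sigma>: "\<sigma> > 0" using assms(2) by (simp add: \<sigma>_def)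

  have shift_nz: "z + of_nat k \<noteq> 0" if "z \<notin> \<int>\<^sub>\<le>\<^sub>0" for z :: complex and k
    using that by (metis add_eq_0_iff2 minus_of_nat_in_nonpos_Ints)
  have cubic_nz: "cubic x1 x2 x3 (- of_nat k) \<noteq> 0" for k
  proof -
    have "cubic x1 x2 x3 (- of_nat k) = - ((x1 + of_nat k) * (x2 + of_nat k) * (x3 + of_nat k))"
      by (simp add: cubic_def algebra_simps)
    then show ?thesis using shift_nz assms by simp
  qed
  have sp0: "shift_prod (f k) 0 (m k) = (-1) powi (m k) * (int_pochhammer (xi s k (r k)) (m k))\<^sup>2" for k
    unfolding f_def m_def by (rule shift_prod_eq_int_pochhammer_square[OF assms(7)])
  have W: "(\<Prod>i = m k + 1..0. f k i) \<noteq> 0" if "m k < 0" for k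
  proof -
    have "int_pochhammer (xi s k (r k)) (m k) \<noteq> 0"
      using assms(8)[of k] that
      by (auto simp: int_pochhammer_def int_pochhammer_well_defined_def m_def)
    then have "shift_prod (f k) 0 (m k) \<noteq> 0" unfolding sp0 by simp
    then show ?thesis using that by (simp add: shift_prod_eq_0_iff)
  qed

  obtain e where e0: "e \<longlonglongrightarrow> 0" and e: "\<And>k t. pole_quadratic s x1 x2 x3 l k t =
            (t - (l + e k)) * (t - (of_int s + of_nat k - (l + e k)))"
    using pole_quadratic_roots by blast
  define \<tau> where "\<tau> = (\<lambda>k. l + e k + 1 - of_int s)"
  have fprod: "(\<Prod>i = n+1..n + m k. f k i) = (\<Prod>j = 2-s..int k. (of_int n)\<^sup>2 - (of_int j - \<tau> k)\<^sup>2)"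
    for n k
    unfolding f_def m_def by (rule prod_pole_quadratic) (simp add: e \<tau>_def)
  have \<tau>_lim: "\<tau> \<longlonglongrightarrow> l + 0 + 1 - of_int s"
    unfolding \<tau>_def by (intro tendsto_intros e0)
  then obtain B where B: "0 \<le> B" "\<And>k. norm (\<tau> k) \<le> B"
    using convergent_imp_Bseq[of \<tau>] by (auto simp: convergent_def Bseq_def intro: less_imp_le)
  \<comment> \<open>half of the limit is enough: the products below enter squared, which restores the exponent \<open>\<sigma>\<close>\<close>
  have "(\<lambda>k. Re (\<tau> k)) \<longlonglongrightarrow> \<sigma>" using tendsto_Re[OF \<tau>_lim] by (simp add: \<sigma>_def)
  then have ev_Re: "eventually (\<lambda>k. Re (\<tau> k) > \<sigma> / 2) sequentially"
    by (rule order_tendstoD) (use \<sigma> in simp)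
  obtain C1 where C1: "\<And>k \<tau>. 1 \<le> k \<Longrightarrow> 2 - s \<le> int k \<Longrightarrow> \<sigma> / 2 \<le> Re \<tau> \<Longrightarrow> norm \<tau> \<le> B \<Longrightarrow>
      norm (\<Prod>j = 2-s..int k. of_int j - \<tau>) \<le> C1 * (fact k * real k powr (- (\<sigma> / 2)))"
    using prod_shifted_upper_bound[of "\<sigma> / 2" B s] \<sigma> B by auto
  obtain C2 N0 where C2: "\<And>N k \<tau>. N0 \<le> N \<Longrightarrow> k < N \<Longrightarrow> 1 \<le> k \<Longrightarrow> 2 - s \<le> int k \<Longrightarrow>
      0 \<le> Re \<tau> \<Longrightarrow> norm \<tau> \<le> B \<Longrightarrow>
      real N powi (2 * (s - 1)) * (\<Prod>j = 1..k. (real N)\<^sup>2 - (real j)\<^sup>2) \<le>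
        C2 * norm (\<Prod>j = 2-s..int k. (of_nat N)\<^sup>2 - (of_int j - \<tau>)\<^sup>2)"
    using prod_shifted_lower_bound[OF B(1), of s] by blast

  have "eventually (\<lambda>k. k \<ge> 1 \<and> 2 - s \<le> int k \<and> Re (\<tau> k) > \<sigma> / 2 \<and>
      norm (reciprocal_term x1 x2 x3 l k) \<le> 8 / real k) sequentially"
    using eventually_ge_at_top[of 1] eventually_ge_at_top[of "nat (2 - s)"] ev_Re
      reciprocal_term_bound[of x1 x2 x3 l]
    by eventually_elim auto
  then obtain K where K: "\<And>k. k \<ge> K \<Longrightarrow> k \<ge> 1 \<and> 2 - s \<le> int k \<and> Re (\<tau> k) > \<sigma> / 2 \<and>
      norm (reciprocal_term x1 x2 x3 l k) \<le> 8 / real k"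
    by (auto simp: eventually_sequentially)

  have large: "shift_prod (f k) (int N) (m k) \<noteq> 0 \<and> norm (U N k) \<le> C2"
    if k: "K \<le> k" "k < N" and N: "N0 \<le> N" for k N
  proof -
    define R where "R = real N powi (2 * (s - 1)) * (\<Prod>j = 1..k. (real N)\<^sup>2 - (real j)\<^sup>2)"
    have R: "R > 0" unfolding R_def using k
      by (intro mult_pos_pos prod_pos) (auto intro!: power_strict_mono)
    have sp: "shift_prod (f k) (int N) (m k) = (\<Prod>j = 2-s..int k. (of_nat N)\<^sup>2 - (of_int j - \<tau> k)\<^sup>2)"
      using K[OF k(1)] fprod[of k "int N"] by (simp add: shift_prod_def m_def)
    have le: "R \<le> C2 * norm (shift_prod (f k) (int N) (m k))"
      unfolding sp R_def by (rule C2) (use k N K[OF k(1)] \<sigma> B in auto)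
    then have nz: "shift_prod (f k) (int N) (m k) \<noteq> 0" using R by auto
    have "U N k = of_real R / shift_prod (f k) (int N) (m k)"
      by (simp add: U_def R_def)
    then have "norm (U N k) = R / norm (shift_prod (f k) (int N) (m k))"
      using R by (simp add: norm_divide)
    then show ?thesis using nz le by (simp add: pos_divide_le_eq)
  qed

  have t_bound: "norm (t k) \<le> 8 * C1\<^sup>2 * real k powr (- 1 - \<sigma>)" if k: "K \<le> k" for k
  proof -
    note Kk = K[OF k]
    have "shift_prod (f k) 0 (m k) = (\<Prod>j = 2-s..int k. - ((of_int j - \<tau> k)\<^sup>2))"
      using Kk fprod[of k 0] by (simp add: shift_prod_def m_def)
    then have "norm (shift_prod (f k) 0 (m k)) = (norm (\<Prod>j = 2-s..int k. of_int j - \<tau> k))\<^sup>2"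
      by (simp add: prod_norm[symmetric] norm_power prod_power_distrib)
    also have "\<dots> \<le> (C1 * (fact k * real k powr (- (\<sigma> / 2))))\<^sup>2"
      by (intro power_mono C1) (use Kk B in auto)
    also have "\<dots> = C1\<^sup>2 * (fact k)\<^sup>2 * real k powr (- \<sigma>)"
      using Kk by (simp add: power_mult_distrib power2_eq_square powr_add[symmetric])
    finally have 1: "norm ((int_pochhammer (xi s k (r k)) (m k))\<^sup>2) \<le> C1\<^sup>2 * (fact k)\<^sup>2 * real k powr (- \<sigma>)"
      unfolding sp0 by (simp add: norm_mult norm_power_int)
    have "norm (t k) = norm ((int_pochhammer (xi s k (r k)) (m k))\<^sup>2) / (fact k)\<^sup>2 *
        norm (reciprocal_term x1 x2 x3 l k)"
      by (simp add: t_def norm_mult norm_divide norm_power_int norm_power)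
    also have "\<dots> \<le> C1\<^sup>2 * real k powr (- \<sigma>) * (8 / real k)"
      using 1 Kk by (intro mult_mono) (auto simp: divide_simps mult_ac)
    also have "\<dots> = 8 * C1\<^sup>2 * real k powr (- 1 - \<sigma>)"
      using Kk by (simp add: powr_diff powr_minus field_simps)
    finally show ?thesis .
  qed

  have tannery: "summable (\<lambda>k. norm (t k))" "(\<lambda>N. suminf (\<lambda>k. a k N)) \<longlonglongrightarrow> suminf t"
  proof -
    have lim: "(\<lambda>N. a k N) \<longlonglongrightarrow> t k" for k
    proof -
      have "(\<lambda>N. t k * U N k) \<longlonglongrightarrow> t k * 1"
        unfolding U_def f_def m_def by (intro tendsto_mult tendsto_const truncation_factor_LIMSEQ(1))
      moreover have "eventually (\<lambda>N. t k * U N k = a k N) sequentially"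
        using eventually_gt_at_top[of k] by eventually_elim (simp add: a_def)
      ultimately show ?thesis by (simp add: tendsto_cong)
    qed
    have "eventually (\<lambda>(k, N). k \<ge> K \<and> N \<ge> N0) (at_top \<times>\<^sub>F sequentially)"
      using eventually_prodI[OF eventually_ge_at_top[of K] eventually_ge_at_top[of N0]]
      by (simp add: case_prod_unfold)
    then have bound: "eventually (\<lambda>(k, N). norm (a k N) \<le> (8 * C1\<^sup>2 * \<bar>C2\<bar>) * real k powr (- 1 - \<sigma>))
        (at_top \<times>\<^sub>F sequentially)"
    proof (rule eventually_mono, safe)
      fix k N assume kN: "K \<le> k" "N0 \<le> N"
      show "norm (a k N) \<le> (8 * C1\<^sup>2 * \<bar>C2\<bar>) * real k powr (- 1 - \<sigma>)"
      proof (cases "k < N")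
        case True
        have "norm (a k N) = norm (t k) * norm (U N k)" using True by (simp add: a_def norm_mult)
        also have "\<dots> \<le> (8 * C1\<^sup>2 * real k powr (- 1 - \<sigma>)) * \<bar>C2\<bar>"
          using t_bound[OF kN(1)] large[OF kN(1) True kN(2)] by (intro mult_mono) auto
        finally show ?thesis by (simp add: mult_ac)
      qed (simp add: a_def)
    qed
    have "summable (\<lambda>k. (8 * C1\<^sup>2 * \<bar>C2\<bar>) * real k powr (- 1 - \<sigma>))"
      using \<sigma> by (intro summable_mult) (simp add: summable_real_powr_iff)
    from tannerys_theorem[OF lim bound this] show "summable (\<lambda>k. norm (t k))"
      "(\<lambda>N. suminf (\<lambda>k. a k N)) \<longlonglongrightarrow> suminf t" by auto
  qed

  have "eventually (\<lambda>N. \<forall>k\<in>{..<K}. shift_prod (f k) (int N) (m k) \<noteq> 0) sequentially"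
    by (intro eventually_ball_finite ballI) (auto simp: f_def m_def intro: truncation_factor_LIMSEQ(2))
  with eventually_ge_at_top[of N0] eventually_gt_at_top[of 0]
  have expansion: "eventually (\<lambda>N. of_nat N powi (2 * s - 3) *
           (\<Prod>j<N. cubic x1 x2 x3 (of_nat (Suc j)) / (- cubic x1 x2 x3 (- of_nat j))) =
         of_nat N powi (2 * s - 3) * (\<Prod>j<N. (of_nat (Suc j) - l) / (l + of_nat j)) +
         suminf (\<lambda>k. a k N)) sequentially"
  proof eventually_elim
    case (elim N)
    have D: "shift_prod (f k) (int N) (m k) \<noteq> 0" if "k < N" for k
      using elim(3) large[of k N] that elim(1) by (cases "k < K") auto
    \<comment> \<open>one sign comes from the truncation coefficient, the other from the squared Pochhammer symbol\<close>
    have sgn: "(-1) ^ k * (-1) powi (m k) = ((-1) powi (s + 1) :: complex)" for k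
    proof -
      have "(-1) ^ k * (-1) powi (m k) = ((-1) powi (int k + m k) :: complex)"
        by (simp add: power_int_add)
      also have "int k + m k = (s + 1) + 2 * (int k - 1)" by (simp add: m_def)
      also have "((-1) powi \<dots> :: complex) = (-1) powi (s + 1)"
        by (subst power_int_add, simp, subst power_int_mult, simp)
      finally show ?thesis .
    qed
    define Z where "Z = (of_nat N :: complex) powi (2 * s - 3)"
    have "of_nat N powi (2 * (s - 1)) = Z * of_nat N"
      using elim(2) power_int_add_1[of "of_nat N :: complex" "2 * s - 3"] by (simp add: Z_def)
    then have U: "U N k = Z * of_nat N * (\<Prod>j = 1..k. (of_nat N)\<^sup>2 - (of_nat j)\<^sup>2) /
        shift_prod (f k) (int N) (m k)" for k
      by (simp only: U_def)
    have finite: "(\<Prod>j<N. cubic x1 x2 x3 (of_nat (Suc j)) / (- cubic x1 x2 x3 (- of_nat j))) =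
       (\<Prod>j<N. (of_nat (Suc j) - l) / (l + of_nat j)) +
       (\<Sum>k<N. (\<Prod>j<N. of_nat (Suc j) + of_nat k) / (\<Prod>j\<in>{..<N}-{k}. of_nat j - of_nat k) *
          reciprocal_term x1 x2 x3 l k *
          (shift_prod (f k) 0 (m k) / shift_prod (f k) (int N) (m k)))"
      unfolding f_def m_def
      by (rule truncated_expansion[OF assms(1)])
         (use shift_nz assms cubic_nz W D in \<open>auto simp: f_def m_def\<close>)
    have summand: "Z * ((\<Prod>j<N. of_nat (Suc j) + of_nat k) /
          (\<Prod>j\<in>{..<N}-{k}. of_nat j - of_nat k) * reciprocal_term x1 x2 x3 l k *
          (shift_prod (f k) 0 (m k) / shift_prod (f k) (int N) (m k))) = a k N" if k: "k < N" for k
      unfolding truncation_coefficient[OF k] sp0 using k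
      by (simp add: a_def t_def U sgn[of k, symmetric] mult_ac)
    have sum: "suminf (\<lambda>k. a k N) = (\<Sum>k<N. a k N)"
      by (rule suminf_finite) (auto simp: a_def)
    show ?case
      unfolding Z_def[symmetric] finite sum distrib_left sum_distrib_left
      by (intro arg_cong2[of _ _ _ _ "(+)"] refl sum.cong summand) auto
  qed
  then have "(\<lambda>N. of_nat N powi (2 * s - 3) *
           (\<Prod>j<N. cubic x1 x2 x3 (of_nat (Suc j)) / (- cubic x1 x2 x3 (- of_nat j)))) \<longlonglongrightarrow> 0 + suminf t"
    unfolding tendsto_cong[OF expansion]
    by (intro tendsto_add value_at_infinity_LIMSEQ tannery(2) assms)
  from LIMSEQ_unique[OF Gamma_product_LIMSEQ[OF assms(1,3,4,5)] this]
  have "suminf t = Gamma x1 * Gamma x2 * Gamma x3 * (rGamma (1 - x1) * rGamma (1 - x2) * rGamma (1 - x3))"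
    by simp
  moreover have "t sums suminf t" by (rule summable_sums[OF summable_norm_cancel[OF tannery(1)]])
  ultimately show ?thesis by (simp add: t_def m_def reciprocal_term_def)
qed

end
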